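(* Let $T\in\mathcal{K}(V)$ be bisectorial of angle $\omega\in(0,\frac{\pi}{2})$, let $\theta\in(\omega,\frac{\pi}{2})$ and $g\in\mathcal{N}^{\mathrm{reg}}(D_\theta)$, with $g(T)$ given by the $H^\infty$-functional calculus. Then: i) For every $B\in\mathcal{B}(V)$ with $TB\supseteq BT$, one has $Bg(T)\subseteq g(T)B$. ii) For every $f\in\mathcal{N}^{\mathrm{bnd}}(D_\theta)$, with $f(T)$ given by the extended $\omega$-functional calculus, one has $f(T)g(T)\subseteq g(T)f(T)$.
   Context: Clifford setting. Fix an integer $n\geq 1$. $\mathbb{R}_n$ is the real Clifford algebra generated by $e_1,\dots,e_n$ with $e_i^2=-1$, $e_ie_j=-e_je_i$ ($i\neq j$), with basis $e_A=e_{i_1}\cdots e_{i_r}$ for $A=(i_1<\dots<i_r)$, $e_\emptyset=1$, and $|s|^2=\sum_As_A^2$ for $s=\sum_As_Ae_A$. Paravectors: $\mathbb{R}^{n+1}=\{s_0+s_1e_1+\dots+s_ne_n\}\subseteq\mathbb{R}_n$ with $\overline{s}=s_0-s_1e_1-\dots-s_ne_n$. $\mathbb{S}=\{s\in\mathbb{R}^{n+1}: s_0=0,|s|=1\}$ and $\mathbb{C}_J=\{x+Jy: x,y\in\mathbb{R}\}$ for $J\in\mathbb{S}$. $U\subseteq\mathbb{R}^{n+1}$ is axially symmetric if $x+Jy\in U$ ($x,y\in\mathbb{R}$, $J\in\mathbb{S}$) implies $x+Iy\in U$ for all $I\in\mathbb{S}$. Slice hyperholomorphic functions. For $U$ open and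 axially symmetric, $f:U\to\mathbb{R}_n$ is left slice hyperholomorphic ($f\in\mathcal{SH}_L(U)$) if there are continuously differentiable $f_0,f_1:\{(x,y)\in\mathbb{R}^2: x+\mathbb{S}y\subseteq U\}\to\mathbb{R}_n$ with $f(x+Jy)=f_0(x,y)+Jf_1(x,y)$ for all $J\in\mathbb{S}$, $f_0(x,-y)=f_0(x,y)$, $f_1(x,-y)=-f_1(x,y)$, $\partial_xf_0=\partial_yf_1$, $\partial_yf_0=-\partial_xf_1$. If $f_0,f_1$ are real valued, $f$ is called intrinsic ($f\in\mathcal{N}(U)$). Operators. $V_\mathbb{R}$ is a real Banach space, $V=\{\sum_Av_A\otimes e_A: v_A\in V_\mathbb{R}\}$ the corresponding Clifford module with norm $\|v\|^2=\sum_A\|v_A\|^2$ and the natural left and right multiplications by $\mathbb{R}_n$. $\mathcal{B}(V)$: bounded everywhere defined right-linear operators; $\mathcal{K}(V)$: closed right-linear operators $T:\operatorname{dom}(T)\to V$ with right-linear domain $\operatorname{dom}(T)\subseteq V$. A Clifford number $a$ is identified with the operator $v\mapsto av$, so $(aT)v=a(Tv)$, $(Ta)v=T(av)$. For operators, $A\subseteq B$ means $\operatorname{dom}(A)\subseteq\operatorname{dom}(B)$ and $Av=Bv$ for $v\in\operatorname{dom}(A)$; products have their natural domains. For $s\in\mathbb{R}^{n+1}$, $Q_s[T]=T^2-2s_0T+|s|^2$ on $\operatorname{dom}(T^2)$; $\rho_S(T)=\{s\in\mathbb{R}^{n+1}: Q_s[T]^{-1}\in\mathcal{B}(V)\}$,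 $\sigma_S(T)=\mathbb{R}^{n+1}\setminus\rho_S(T)$, and $S_L^{-1}(s,T)=Q_s[T]^{-1}\overline{s}-TQ_s[T]^{-1}$ for $s\in\rho_S(T)$. Bisectorial operators. For $\omega\in(0,\frac{\pi}{2})$, $I_\omega=(-\omega,\omega)\cup(\pi-\omega,\pi+\omega)$ and $D_\omega=\{re^{J\phi}: r>0,\,J\in\mathbb{S},\,\phi\in I_\omega\}\subseteq\mathbb{R}^{n+1}$. $T\in\mathcal{K}(V)$ is bisectorial of angle $\omega$ if $\sigma_S(T)\subseteq\overline{D_\omega}$ and for every $\varphi\in(\omega,\frac{\pi}{2})$ there is $C_\varphi\geq 0$ with $\|S_L^{-1}(s,T)\|\leq\frac{C_\varphi}{|s|}$ for all $s\in\mathbb{R}^{n+1}\setminus(D_\varphi\cup\{0\})$. $\omega$-functional calculus. $\mathcal{SH}_L^0(D_\theta)$ is the set of bounded $f\in\mathcal{SH}_L(D_\theta)$ with $\int_0^\infty|f(te^{J\phi})|\frac{dt}{t}<\infty$ for all $J\in\mathbb{S}$, $\phi\in I_\theta$; $\mathcal{N}^0(D_\theta)$ is the set of intrinsic such functions. For $T$ bisectorial of angle $\omega$, $\theta\in(\omega,\frac{\pi}{2})$ and $f\in\mathcal{SH}_L^0(D_\theta)$, $$f(T)=\frac{1}{2\pi}\int_{\partial D_\varphi\cap\mathbb{C}_J}S_L^{-1}(s,T)ds_Jf(s):=\frac{1}{2\pi}\sum_\pm\int_\mathbb{R}S_L^{-1}(\gamma_\pm(t),T)\frac{\gamma_\pm'(t)}{J}f(\gamma_\pm(t))dt\in\mathcal{B}(V),$$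 with $\gamma_\pm(t)=\pm|t|e^{-\operatorname{sgn}(t)J\varphi}$; it does not depend on the choice of $\varphi\in(\omega,\theta)$ and $J\in\mathbb{S}$. Extended $\omega$-functional calculus. $\mathcal{N}^{\mathrm{bnd}}(D_\theta)$ is the set of functions $g(s)=g_\infty+\frac{1}{1+s^2}(g_0-g_\infty)+\widetilde{g}(s)$ on $D_\theta$ with $g_0,g_\infty\in\mathbb{R}$, $\widetilde{g}\in\mathcal{N}^0(D_\theta)$ (unique components). For such $g$, $g(T):=g_\infty+(1+T^2)^{-1}(g_0-g_\infty)+\widetilde{g}(T)\in\mathcal{B}(V)$; here $1+T^2$ is boundedly invertible since $\mathbb{S}\subseteq\rho_S(T)$. $H^\infty$-functional calculus. $\mathcal{N}^{\mathrm{reg}}(D_\theta)$ is the set of $g\in\mathcal{N}(D_\theta)$ for which there exists $e\in\mathcal{N}^{\mathrm{bnd}}(D_\theta)$ (a regularizer of $g$) with $eg\in\mathcal{N}^{\mathrm{bnd}}(D_\theta)$ and $e(T)$ injective. For such $g$, $g(T):=e(T)^{-1}(eg)(T)$ with its natural domain $\operatorname{dom}(g(T))=\{v\in V: (eg)(T)v\in\operatorname{ran}(e(T))\}$; this closed operator is independent of the regularizer $e$. *)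

theory Defs
  imports "HOL-Analysis.Analysis"
begin

section \<open>The Clifford algebra\<close>

text \<open>
  The generators are indexed by a finite linearly ordered type \<^typ>\<open>'n\<close> (so $n$ is its cardinality,
  and $n \geq 1$); the basis element $e_A$ is indexed by the set $A$, and a Clifford
  number is its family of coefficients $(s_A)_A$.  A separate type is used because the multiplication
  of \<^typ>\<open>real ^ 'n set\<close> is the componentwise one.
\<close>

typedef 'n clifford = "UNIV :: (real ^ 'n set) set"
  morphisms coeffs Clifford ..

setup_lifting type_definition_clifford

text \<open>
  $e_A e_B = \pm e_{A \triangle B}$: each pair $i \in A$, $j \in B$ with $i > j$ needs a transposition,
  and each $i \in A \cap B$ contributes $e_i^2 = -1$.
\<close>

definition clifford_sign :: "'n::{finite,linorder} set \<Rightarrow> 'n set \<Rightarrow> real" where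
  "clifford_sign A B = (-1) ^ card {(i, j). i \<in> A \<and> j \<in> B \<and> i \<ge> j}"

lemma clifford_sign_prod:
  "clifford_sign A B = (\<Prod>i\<in>A. \<Prod>j\<in>B. if j \<le> i then -1 else 1)"
proof -
  have "(\<Prod>i\<in>A. \<Prod>j\<in>B. if j \<le> i then -1 else 1)
      = (\<Prod>p\<in>A \<times> B. if snd p \<le> fst p then -1 else (1::real))"
    by (simp add: prod.cartesian_product case_prod_unfold)
  also have "\<dots> = (-1) ^ card ((A \<times> B) \<inter> {p. snd p \<le> fst p})"
    by (simp add: prod.If_cases)
  also have "(A \<times> B) \<inter> {p. snd p \<le> fst p} = {(i, j). i \<in> A \<and> j \<in> B \<and> i \<ge> j}"
    by auto
  finally show ?thesis
    by (simp add: clifford_sign_def)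
qed

lemma prod_sym_diff:
  fixes f :: "'n::finite \<Rightarrow> real"
  assumes "\<And>i. f i * f i = 1"
  shows "prod f (sym_diff A B) = prod f A * prod f B"
proof -
  have sq: "prod f (A \<inter> B) * prod f (A \<inter> B) = 1"
    by (simp add: prod.distrib[symmetric] assms)
  have "prod f A * prod f B
      = (prod f (A - B) * prod f (A \<inter> B)) * (prod f (B - A) * prod f (A \<inter> B))"
    using prod.Int_Diff[of A f B] prod.Int_Diff[of B f A] by (simp add: Int_commute mult.commute)
  also have "\<dots> = (prod f (A - B) * prod f (B - A)) * (prod f (A \<inter> B) * prod f (A \<inter> B))"
    by (simp add: algebra_simps)
  also have "\<dots> = prod f (sym_diff A B)"
    unfolding sq by (subst prod.union_disjoint) auto
  finally show ?thesis by simp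
qed

lemma clifford_sign_sym_diff_left:
  "clifford_sign (sym_diff A B) C = clifford_sign A C * clifford_sign B C"
  unfolding clifford_sign_prod
  by (rule prod_sym_diff) (auto simp: prod.distrib[symmetric] intro!: prod.neutral)

lemma clifford_sign_sym_diff_right:
  "clifford_sign A (sym_diff B C) = clifford_sign A B * clifford_sign A C"
  unfolding clifford_sign_prod prod.distrib[symmetric]
  by (intro prod.cong refl prod_sym_diff) auto

lemma clifford_sign_empty [simp]: "clifford_sign {} B = 1" "clifford_sign A {} = 1"
  by (simp_all add: clifford_sign_def)

lemma clifford_sign_assoc:
  "clifford_sign C (sym_diff C D) * clifford_sign A (sym_diff A C)
   = clifford_sign A (sym_diff A D) * clifford_sign (sym_diff A C) (sym_diff C D)"
proof -
  have "sym_diff A D = sym_diff (sym_diff A C) (sym_diff C D)"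
    by auto
  then have "clifford_sign A (sym_diff A D)
      = clifford_sign A (sym_diff A C) * clifford_sign A (sym_diff C D)"
    by (simp only: clifford_sign_sym_diff_right)
  moreover have "clifford_sign (sym_diff A C) (sym_diff C D)
      = clifford_sign A (sym_diff C D) * clifford_sign C (sym_diff C D)"
    by (simp only: clifford_sign_sym_diff_left)
  moreover have "clifford_sign A (sym_diff C D) * clifford_sign A (sym_diff C D) = 1"
    by (simp add: clifford_sign_def power_mult_distrib[symmetric])
  ultimately show ?thesis
    by (simp add: algebra_simps)
qed

lemma sum_axis_sym_diff_nth:
  fixes x :: "'n::finite set \<Rightarrow> 'n set \<Rightarrow> 'b::comm_monoid_add"
  shows "(\<Sum>A\<in>UNIV. \<Sum>B\<in>UNIV. axis (sym_diff A B) (x A B)) $ C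
         = (\<Sum>A\<in>UNIV. x A (sym_diff A C))"
proof -
  have "(\<Sum>B\<in>UNIV. axis (sym_diff A B) (x A B) $ C) = x A (sym_diff A C)" for A
  proof -
    have "(\<Sum>B\<in>UNIV. axis (sym_diff A B) (x A B) $ C)
        = (\<Sum>B\<in>UNIV. if B = sym_diff A C then x A B else 0)"
      by (rule sum.cong) (auto simp: axis_def)
    then show ?thesis by simp
  qed
  then show ?thesis by simp
qed

lemma sum_sym_diff_reindex:
  fixes g :: "'n::finite set \<Rightarrow> 'b::comm_monoid_add"
  shows "(\<Sum>B\<in>UNIV. g (sym_diff A B)) = (\<Sum>B\<in>UNIV. g B)"
  by (rule sum.reindex_bij_witness[of _ "sym_diff A" "sym_diff A"])
    (auto simp: set_eq_iff intro!: arg_cong[of _ _ g])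

text \<open>
  $V = V_{\mathbb{R}} \otimes \mathbb{R}_n$ is \<^typ>\<open>'v ^ 'n set\<close>, whose library norm is
  $\|v\|^2 = \sum_A \|v_A\|^2$; the elementary tensor $w \otimes e_C$ is \<^term>\<open>axis C w\<close>.
  These are the products of a coefficient family with a module element.
\<close>

definition twisted_left :: "real ^ 'n set \<Rightarrow> 'v::real_vector ^ 'n set \<Rightarrow> 'v ^ 'n::{finite,linorder} set" where
  "twisted_left a v = (\<Sum>A\<in>UNIV. \<Sum>B\<in>UNIV. axis (sym_diff A B) ((clifford_sign A B * a $ A) *\<^sub>R v $ B))"

definition twisted_right :: "'v::real_vector ^ 'n set \<Rightarrow> real ^ 'n set \<Rightarrow> 'v ^ 'n::{finite,linorder} set" where
  "twisted_right v a = (\<Sum>A\<in>UNIV. \<Sum>B\<in>UNIV. axis (sym_diff A B) ((clifford_sign A B * a $ B) *\<^sub>R v $ A))"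

lemma twisted_left_nth:
  "twisted_left a v $ C = (\<Sum>A\<in>UNIV. (clifford_sign A (sym_diff A C) * a $ A) *\<^sub>R v $ sym_diff A C)"
  unfolding twisted_left_def by (rule sum_axis_sym_diff_nth)

lemma twisted_right_nth:
  "twisted_right v a $ C = (\<Sum>A\<in>UNIV. (clifford_sign A (sym_diff A C) * a $ sym_diff A C) *\<^sub>R v $ A)"
  unfolding twisted_right_def by (rule sum_axis_sym_diff_nth)

lemma twisted_right_eq_left: "twisted_right a b = twisted_left a (b :: real ^ 'n::{finite,linorder} set)"
  by (simp add: twisted_left_def twisted_right_def mult_ac)

lemma twisted_left_assoc: "twisted_left (twisted_left a b) v = twisted_left a (twisted_left b v)"
proof (rule vec_eq_iff[THEN iffD2], rule allI)
  fix D
  have "twisted_left (twisted_left a b) v $ D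
      = (\<Sum>C\<in>UNIV. \<Sum>A\<in>UNIV. (clifford_sign C (sym_diff C D) * clifford_sign A (sym_diff A C)
           * a $ A * b $ sym_diff A C) *\<^sub>R v $ sym_diff C D)"
    by (simp only: twisted_left_nth real_scaleR_def sum_distrib_left scaleR_sum_left mult.assoc)
  also have "\<dots> = (\<Sum>A\<in>UNIV. \<Sum>C\<in>UNIV. (clifford_sign A (sym_diff A D)
           * clifford_sign (sym_diff A C) (sym_diff C D) * a $ A * b $ sym_diff A C) *\<^sub>R v $ sym_diff C D)"
    unfolding clifford_sign_assoc by (rule sum.swap)
  also have "\<dots> = (\<Sum>A\<in>UNIV. \<Sum>B\<in>UNIV. (clifford_sign A (sym_diff A D)
           * clifford_sign B (sym_diff B (sym_diff A D)) * a $ A * b $ B) *\<^sub>R v $ sym_diff B (sym_diff A D))"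
  proof (rule sum.cong[OF refl])
    fix A
    have *: "sym_diff (sym_diff A C) (sym_diff A D) = sym_diff C D" for C
      by auto
    show "(\<Sum>C\<in>UNIV. (clifford_sign A (sym_diff A D)
           * clifford_sign (sym_diff A C) (sym_diff C D) * a $ A * b $ sym_diff A C) *\<^sub>R v $ sym_diff C D)
        = (\<Sum>B\<in>UNIV. (clifford_sign A (sym_diff A D)
           * clifford_sign B (sym_diff B (sym_diff A D)) * a $ A * b $ B) *\<^sub>R v $ sym_diff B (sym_diff A D))"
      using sum_sym_diff_reindex[where A = A and g = "\<lambda>B. (clifford_sign A (sym_diff A D)
           * clifford_sign B (sym_diff B (sym_diff A D)) * a $ A * b $ B) *\<^sub>R v $ sym_diff B (sym_diff A D)"]
      unfolding * .
  qed
  also have "\<dots> = twisted_left a (twisted_left b v) $ D"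
    by (simp only: twisted_left_nth scaleR_sum_right scaleR_scaleR mult_ac)
  finally show "twisted_left (twisted_left a b) v $ D = twisted_left a (twisted_left b v) $ D" .
qed

lemma twisted_left_one:
  fixes v :: "'v::real_vector ^ 'n::{finite,linorder} set"
  shows "twisted_left (axis {} 1) v = v"
proof -
  have "(\<Sum>A\<in>UNIV. (clifford_sign A (sym_diff A C) * axis {} 1 $ A) *\<^sub>R v $ sym_diff A C)
      = (\<Sum>A\<in>UNIV. if A = ({} :: 'n set) then v $ C else 0)" for C
    by (rule sum.cong) (auto simp: axis_def)
  then show ?thesis
    by (simp add: vec_eq_iff twisted_left_nth)
qed

lemma twisted_right_one: "twisted_right v (axis {} 1) = v"
proof -
  have "(\<Sum>A\<in>UNIV. (clifford_sign A (sym_diff A C) * axis {} 1 $ sym_diff A C) *\<^sub>R v $ A)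
      = (\<Sum>A\<in>UNIV. if A = C then v $ C else 0)" for C
    by (rule sum.cong) (auto simp: axis_def)
  then show ?thesis
    by (simp add: vec_eq_iff twisted_right_nth)
qed

lemma twisted_left_add_left: "twisted_left (a + b) v = twisted_left a v + twisted_left b v"
  and twisted_left_add_right: "twisted_left a (v + w) = twisted_left a v + twisted_left a w"
  and twisted_left_scaleR_left: "twisted_left (r *\<^sub>R a) v = r *\<^sub>R twisted_left a v"
  and twisted_left_scaleR_right: "twisted_left a (r *\<^sub>R v) = r *\<^sub>R twisted_left a v"
  by (simp_all add: vec_eq_iff twisted_left_nth sum.distrib[symmetric] scaleR_sum_right algebra_simps)

instantiation clifford :: ("{finite,linorder}") real_algebra_1
begin

lift_definition zero_clifford :: "'a clifford" is 0 .
lift_definition one_clifford :: "'a clifford" is "axis {} 1" .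
lift_definition plus_clifford :: "'a clifford \<Rightarrow> 'a clifford \<Rightarrow> 'a clifford" is "(+)" .
lift_definition minus_clifford :: "'a clifford \<Rightarrow> 'a clifford \<Rightarrow> 'a clifford" is "(-)" .
lift_definition uminus_clifford :: "'a clifford \<Rightarrow> 'a clifford" is uminus .
lift_definition scaleR_clifford :: "real \<Rightarrow> 'a clifford \<Rightarrow> 'a clifford" is scaleR .
lift_definition times_clifford :: "'a clifford \<Rightarrow> 'a clifford \<Rightarrow> 'a clifford" is twisted_left .

instance
proof
  fix a b c :: "'a clifford" and r q :: real
  show "a + b + c = a + (b + c)" by transfer (rule add.assoc)
  show "a + b = b + a" by transfer (rule add.commute)
  show "0 + a = a" by transfer simp
  show "- a + a = 0" by transfer simp
  show "a - b = a + - b" by transfer simp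
  show "r *\<^sub>R (a + b) = r *\<^sub>R a + r *\<^sub>R b" by transfer (rule scaleR_add_right)
  show "(r + q) *\<^sub>R a = r *\<^sub>R a + q *\<^sub>R a" by transfer (rule scaleR_add_left)
  show "r *\<^sub>R q *\<^sub>R a = (r * q) *\<^sub>R a" by transfer simp
  show "1 *\<^sub>R a = a" by transfer simp
  show "a * b * c = a * (b * c)" by transfer (rule twisted_left_assoc)
  show "1 * a = a" by transfer (rule twisted_left_one)
  show "a * 1 = a" by transfer (metis twisted_right_one twisted_right_eq_left)
  show "(a + b) * c = a * c + b * c" by transfer (rule twisted_left_add_left)
  show "a * (b + c) = a * b + a * c" by transfer (rule twisted_left_add_right)
  show "r *\<^sub>R a * b = r *\<^sub>R (a * b)" by transfer (rule twisted_left_scaleR_left)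
  show "a * r *\<^sub>R b = r *\<^sub>R (a * b)" by transfer (rule twisted_left_scaleR_right)
  show "(0::'a clifford) \<noteq> 1" by transfer (simp add: axis_eq_0_iff[symmetric])
qed

end

instantiation clifford :: ("{finite,linorder}") euclidean_space
begin

lift_definition norm_clifford :: "'a clifford \<Rightarrow> real" is norm .
lift_definition inner_clifford :: "'a clifford \<Rightarrow> 'a clifford \<Rightarrow> real" is inner .
lift_definition dist_clifford :: "'a clifford \<Rightarrow> 'a clifford \<Rightarrow> real" is dist .
lift_definition sgn_clifford :: "'a clifford \<Rightarrow> 'a clifford" is sgn .
lift_definition Basis_clifford :: "'a clifford set" is Basis .

definition uniformity_clifford :: "('a clifford \<times> 'a clifford) filter" where
  "uniformity_clifford = (INF e\<in>{0 <..}. principal {(x, y). dist x y < e})"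

definition open_clifford :: "'a clifford set \<Rightarrow> bool" where
  "open_clifford U \<longleftrightarrow> (\<forall>x\<in>U. eventually (\<lambda>(x', y). x' = x \<longrightarrow> y \<in> U) uniformity)"

instance
proof
  fix x y z :: "'a clifford" and r :: real
  show "dist x y = norm (x - y)" by transfer (rule dist_norm)
  show "sgn x = inverse (norm x) *\<^sub>R x" by transfer (rule sgn_div_norm)
  show "uniformity = (INF e\<in>{0 <..}. principal {(x::'a clifford, y). dist x y < e})"
    by (rule uniformity_clifford_def)
  show "open U = (\<forall>x\<in>U. \<forall>\<^sub>F (x', y) in uniformity. x' = x \<longrightarrow> y \<in> U)" for U :: "'a clifford set"
    by (rule open_clifford_def)
  show "inner x y = inner y x" by transfer (rule inner_commute)
  show "inner (x + y) z = inner x z + inner y z" by transfer (rule inner_add_left)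
  show "inner (r *\<^sub>R x) y = r * inner x y" by transfer simp
  show "0 \<le> inner x x" by transfer simp
  show "inner x x = 0 \<longleftrightarrow> x = 0" by transfer simp
  show "norm x = sqrt (inner x x)" by transfer (rule norm_eq_sqrt_inner)
  show "(Basis :: 'a clifford set) \<noteq> {}" by transfer simp
  show "finite (Basis :: 'a clifford set)" by transfer simp
  show "x \<in> Basis \<Longrightarrow> y \<in> Basis \<Longrightarrow> inner x y = (if x = y then 1 else 0)"
    by transfer (rule inner_Basis)
  show "(\<forall>u\<in>Basis. inner x u = 0) \<longleftrightarrow> x = 0"
    by transfer (rule euclidean_all_zero_iff)
qed

end


definition clifford_basis :: "'n::{finite,linorder} set \<Rightarrow> 'n clifford" where
  "clifford_basis A = Clifford (axis A 1)"

abbreviation gen :: "'n::{finite,linorder} \<Rightarrow> 'n clifford" where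
  "gen i \<equiv> clifford_basis {i}"

lemma clifford_basis_empty: "clifford_basis {} = 1"
  by (simp add: clifford_basis_def one_clifford_def)

lemma clifford_basis_mult:
  "clifford_basis A * clifford_basis B = clifford_sign A B *\<^sub>R clifford_basis (sym_diff A B)"
proof -
  have "(\<Sum>A'\<in>UNIV. (clifford_sign A' (sym_diff A' C) * axis A 1 $ A') *\<^sub>R axis B (1::real) $ sym_diff A' C)
      = (\<Sum>A'\<in>UNIV. if A' = A then (if C = sym_diff A B then clifford_sign A B else 0) else 0)" for C
    by (rule sum.cong) (auto simp: axis_def)
  then have "twisted_left (axis A 1) (axis B 1) = clifford_sign A B *\<^sub>R axis (sym_diff A B) (1::real)"
    by (simp add: vec_eq_iff twisted_left_nth) (simp add: axis_def)
  then show ?thesis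
    unfolding clifford_basis_def times_clifford.abs_eq scaleR_clifford.abs_eq by (simp add: eq_onp_same_args)
qed

lemma gen_square: "gen i * gen i = -1"
  and gen_anticommute: "i \<noteq> j \<Longrightarrow> gen i * gen j = - (gen j * gen i)"
  and clifford_basis_prod: "clifford_basis A = prod_list (map gen (sorted_list_of_set A))"
proof -
  have "{(a, b). a = i \<and> b = i \<and> b \<le> a} = {(i, i)}" by auto
  then show "gen i * gen i = -1"
    by (simp add: clifford_basis_mult clifford_sign_def clifford_basis_empty)
  show "gen i * gen j = - (gen j * gen i)" if "i \<noteq> j"
  proof -
    have "sym_diff {i} {j} = sym_diff {j} {i}" by auto
    moreover have "clifford_sign {i} {j} = - clifford_sign {j} {i}"
      using that by (auto simp: clifford_sign_prod)
    ultimately show ?thesis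
      by (simp only: clifford_basis_mult scaleR_minus_left)
  qed
  have "finite A" by simp
  then show "clifford_basis A = prod_list (map gen (sorted_list_of_set A))"
  proof (induction A rule: finite_linorder_min_induct)
    case empty
    show ?case by (simp add: clifford_basis_empty)
  next
    case (insert b A)
    have "clifford_sign {b} A = 1" "sym_diff {b} A = insert b A"
      using insert.hyps by (force simp: clifford_sign_prod intro!: prod.neutral)+
    then have "gen b * clifford_basis A = clifford_basis (insert b A)"
      by (simp only: clifford_basis_mult scaleR_one)
    moreover have "sorted_list_of_set (insert b A) = b # sorted_list_of_set A"
      using insert.hyps by (intro sorted_list_of_set_unique[THEN iffD1]) auto
    ultimately show ?case
      using insert.IH by simp
  qed
qed

definition scalar_part :: "'n::{finite,linorder} clifford \<Rightarrow> real" where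
  "scalar_part s = coeffs s $ {}"

definition paravectors :: "'n::{finite,linorder} clifford set" where
  "paravectors = {of_real x0 + (\<Sum>i\<in>UNIV. x i *\<^sub>R gen i) | x0 x. True}"

definition paravector_conj :: "'n::{finite,linorder} clifford \<Rightarrow> 'n clifford" where
  "paravector_conj s = of_real (scalar_part s) - (\<Sum>i\<in>UNIV. (coeffs s $ {i}) *\<^sub>R gen i)"

definition imag_units :: "'n::{finite,linorder} clifford set" where
  "imag_units = {s \<in> paravectors. scalar_part s = 0 \<and> norm s = 1}"

definition clifford_inverse :: "'n::{finite,linorder} clifford \<Rightarrow> 'n clifford" where
  "clifford_inverse a = (THE b. a * b = 1 \<and> b * a = 1)"


section \<open>Slice hyperholomorphic functions\<close>

definition slice_point :: "'n::{finite,linorder} clifford \<Rightarrow> real \<Rightarrow> real \<Rightarrow> 'n clifford" where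
  "slice_point J x y = of_real x + J * of_real y"

definition slice_params :: "'n::{finite,linorder} clifford set \<Rightarrow> (real \<times> real) set" where
  "slice_params U = {(x, y). \<forall>J\<in>imag_units. slice_point J x y \<in> U}"

definition C1_on :: "'a::real_normed_vector set \<Rightarrow> ('a \<Rightarrow> 'b::real_normed_vector) \<Rightarrow> bool" where
  "C1_on D h \<longleftrightarrow> (\<exists>h'. (\<forall>z\<in>D. (h has_derivative blinfun_apply (h' z)) (at z)) \<and> continuous_on D h')"

definition partial_x :: "(real \<times> real \<Rightarrow> 'b::real_normed_vector) \<Rightarrow> real \<Rightarrow> real \<Rightarrow> 'b" where
  "partial_x h x y = vector_derivative (\<lambda>t. h (t, y)) (at x)"

definition partial_y :: "(real \<times> real \<Rightarrow> 'b::real_normed_vector) \<Rightarrow> real \<Rightarrow> real \<Rightarrow> 'b" where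
  "partial_y h x y = vector_derivative (\<lambda>t. h (x, t)) (at y)"

text \<open>
  Functions on a set $U$ are total functions here, constrained on $U$ only; \<^term>\<open>U\<close> is understood
  to be an open, axially symmetric subset of the paravectors (below it is always a double sector).
\<close>

definition slice_components ::
  "'n::{finite,linorder} clifford set \<Rightarrow> ('n clifford \<Rightarrow> 'n clifford)
    \<Rightarrow> (real \<times> real \<Rightarrow> 'n clifford) \<Rightarrow> (real \<times> real \<Rightarrow> 'n clifford) \<Rightarrow> bool" where
  "slice_components U f f0 f1 \<longleftrightarrow>
     C1_on (slice_params U) f0 \<and> C1_on (slice_params U) f1 \<and>
     (\<forall>(x, y)\<in>slice_params U.
        (\<forall>J\<in>imag_units. f (slice_point J x y) = f0 (x, y) + J * f1 (x, y)) \<and>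
        f0 (x, - y) = f0 (x, y) \<and> f1 (x, - y) = - f1 (x, y) \<and>
        partial_x f0 x y = partial_y f1 x y \<and> partial_y f0 x y = - partial_x f1 x y)"

definition SH_L :: "'n::{finite,linorder} clifford set \<Rightarrow> ('n clifford \<Rightarrow> 'n clifford) set" where
  "SH_L U = {f. \<exists>f0 f1. slice_components U f f0 f1}"

definition intrinsic :: "'n::{finite,linorder} clifford set \<Rightarrow> ('n clifford \<Rightarrow> 'n clifford) set" where
  "intrinsic U = {f. \<exists>f0 f1. slice_components U f f0 f1 \<and>
                       (\<forall>z\<in>slice_params U. f0 z \<in> \<real> \<and> f1 z \<in> \<real>)}"


section \<open>Operators on the Clifford module\<close>

type_synonym ('v, 'n) cmodule = "'v ^ 'n set"

definition lmult :: "'n::{finite,linorder} clifford \<Rightarrow> ('v::real_vector, 'n) cmodule \<Rightarrow> ('v, 'n) cmodule" where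
  "lmult a v = twisted_left (coeffs a) v"

definition rmult :: "('v::real_vector, 'n::{finite,linorder}) cmodule \<Rightarrow> 'n clifford \<Rightarrow> ('v, 'n) cmodule" where
  "rmult v a = twisted_right v (coeffs a)"

text \<open>
  Unbounded operators are partial functions: \<^term>\<open>dom T\<close> is the domain, \<^term>\<open>S \<subseteq>\<^sub>m T\<close> is the
  inclusion of operators and \<^term>\<open>S \<circ>\<^sub>m T\<close> the product with its natural domain.
\<close>

type_synonym ('v, 'n) operator = "('v, 'n) cmodule \<rightharpoonup> ('v, 'n) cmodule"

type_synonym ('v, 'n) bounded_operator = "('v, 'n) cmodule \<Rightarrow>\<^sub>L ('v, 'n) cmodule"

definition closed_operators :: "('v::real_normed_vector, 'n::{finite,linorder}) operator set" where
  "closed_operators = {T.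
     0 \<in> dom T \<and>
     (\<forall>v\<in>dom T. \<forall>w\<in>dom T. T (v + w) = Some (the (T v) + the (T w))) \<and>
     (\<forall>v\<in>dom T. \<forall>a. T (rmult v a) = Some (rmult (the (T v)) a)) \<and>
     closed (Map.graph T)}"

definition bounded_operators :: "('v::real_normed_vector, 'n::{finite,linorder}) bounded_operator set" where
  "bounded_operators = {B. \<forall>v a. blinfun_apply B (rmult v a) = rmult (blinfun_apply B v) a}"

definition total_op :: "('v::real_normed_vector, 'n::{finite,linorder}) bounded_operator \<Rightarrow> ('v, 'n) operator" where
  "total_op B = (\<lambda>v. Some (blinfun_apply B v))"

definition is_bounded_inverse ::
  "('v::real_normed_vector, 'n::{finite,linorder}) operator \<Rightarrow> ('v, 'n) bounded_operator \<Rightarrow> bool" where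
  "is_bounded_inverse A R \<longleftrightarrow> R \<in> bounded_operators \<and> Map.graph (total_op R) = (Map.graph A)\<inverse>"

definition bounded_inverse ::
  "('v::real_normed_vector, 'n::{finite,linorder}) operator \<Rightarrow> ('v, 'n) bounded_operator" where
  "bounded_inverse A = (THE R. is_bounded_inverse A R)"

definition Q_op :: "'n clifford \<Rightarrow> ('v::real_normed_vector, 'n::{finite,linorder}) operator \<Rightarrow> ('v, 'n) operator" where
  "Q_op s T = (\<lambda>v. if v \<in> dom (T \<circ>\<^sub>m T)
     then Some (the ((T \<circ>\<^sub>m T) v) - (2 * scalar_part s) *\<^sub>R the (T v) + (norm s)\<^sup>2 *\<^sub>R v) else None)"

definition one_plus_square :: "('v::real_normed_vector, 'n::{finite,linorder}) operator \<Rightarrow> ('v, 'n) operator" where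
  "one_plus_square T = (\<lambda>v. if v \<in> dom (T \<circ>\<^sub>m T) then Some (v + the ((T \<circ>\<^sub>m T) v)) else None)"

definition S_resolvent_set :: "('v::real_normed_vector, 'n::{finite,linorder}) operator \<Rightarrow> 'n clifford set" where
  "S_resolvent_set T = {s \<in> paravectors. \<exists>R. is_bounded_inverse (Q_op s T) R}"

definition S_spectrum :: "('v::real_normed_vector, 'n::{finite,linorder}) operator \<Rightarrow> 'n clifford set" where
  "S_spectrum T = paravectors - S_resolvent_set T"

text \<open>
  Everywhere defined for \<^term>\<open>s\<close> in the S-resolvent set of \<^term>\<open>T\<close>, since the range of
  $Q_s[T]^{-1}$ is the domain of $T^2$.
\<close>

definition S_L_inv ::
  "'n clifford \<Rightarrow> ('v::real_normed_vector, 'n::{finite,linorder}) operator \<Rightarrow> ('v, 'n) cmodule \<Rightarrow> ('v, 'n) cmodule" where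
  "S_L_inv s T v = blinfun_apply (bounded_inverse (Q_op s T)) (lmult (paravector_conj s) v)
                   - the (T (blinfun_apply (bounded_inverse (Q_op s T)) v))"


section \<open>Bisectorial operators\<close>

text \<open>$e^{J \varphi}$ for an imaginary unit \<^term>\<open>J\<close>.\<close>

definition exp_unit :: "'n::{finite,linorder} clifford \<Rightarrow> real \<Rightarrow> 'n clifford" where
  "exp_unit J \<phi> = slice_point J (cos \<phi>) (sin \<phi>)"

definition sector_angles :: "real \<Rightarrow> real set" where
  "sector_angles \<omega> = {-\<omega><..<\<omega>} \<union> {pi - \<omega><..<pi + \<omega>}"

definition double_sector :: "real \<Rightarrow> 'n::{finite,linorder} clifford set" where
  "double_sector \<omega> = {r *\<^sub>R exp_unit J \<phi> | r J \<phi>. r > 0 \<and> J \<in> imag_units \<and> \<phi> \<in> sector_angles \<omega>}"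

text \<open>
  Boundedness of $S_L^{-1}(s,T)$ is automatic for closed \<^term>\<open>T\<close> (closed graph theorem); it is
  stated because \<^const>\<open>onorm\<close> is the operator norm for bounded operators only.
\<close>

definition bisectorial :: "real \<Rightarrow> ('v::real_normed_vector, 'n::{finite,linorder}) operator \<Rightarrow> bool" where
  "bisectorial \<omega> T \<longleftrightarrow>
     S_spectrum T \<subseteq> closure (double_sector \<omega>) \<and>
     (\<forall>\<phi>\<in>{\<omega><..<pi/2}. \<exists>C\<ge>0. \<forall>s\<in>paravectors - (double_sector \<phi> \<union> {0}).
        bounded_linear (S_L_inv s T) \<and> onorm (S_L_inv s T) \<le> C / norm s)"


section \<open>Functional calculi\<close>

definition SH_L0 :: "real \<Rightarrow> ('n::{finite,linorder} clifford \<Rightarrow> 'n clifford) set" where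
  "SH_L0 \<theta> = {f \<in> SH_L (double_sector \<theta>). bounded (f ` double_sector \<theta>) \<and>
     (\<forall>J\<in>imag_units. \<forall>\<phi>\<in>sector_angles \<theta>.
        set_integrable lborel {0<..} (\<lambda>t. norm (f (t *\<^sub>R exp_unit J \<phi>)) / t))}"

definition N0 :: "real \<Rightarrow> ('n::{finite,linorder} clifford \<Rightarrow> 'n clifford) set" where
  "N0 \<theta> = SH_L0 \<theta> \<inter> intrinsic (double_sector \<theta>)"

text \<open>The curves $\gamma_{\pm}$, with the sign \<^term>\<open>\<sigma>\<close> as a parameter.\<close>

definition sector_path :: "real \<Rightarrow> 'n::{finite,linorder} clifford \<Rightarrow> real \<Rightarrow> real \<Rightarrow> 'n clifford" where
  "sector_path \<phi> J \<sigma> t = (\<sigma> * \<bar>t\<bar>) *\<^sub>R exp_unit J (- sgn t * \<phi>)"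

text \<open>
  The integrand is, for the operators and functions considered, norm continuous away from $0$ and
  absolutely integrable.  The Henstock--Kurzweil integral is used because the library's Bochner
  integral needs a separable space, which the space of bounded operators is not in general.
\<close>

definition omega_integral ::
  "real \<Rightarrow> 'n clifford \<Rightarrow> ('v::banach, 'n::{finite,linorder}) operator
    \<Rightarrow> ('n clifford \<Rightarrow> 'n clifford) \<Rightarrow> ('v, 'n) bounded_operator" where
  "omega_integral \<phi> J T f = (1 / (2 * pi)) *\<^sub>R (\<Sum>\<sigma>\<in>{1, -1}. integral UNIV (\<lambda>t.
     Blinfun (\<lambda>v. S_L_inv (sector_path \<phi> J \<sigma> t) T
       (lmult (vector_derivative (sector_path \<phi> J \<sigma>) (at t) * clifford_inverse J * f (sector_path \<phi> J \<sigma> t)) v))))"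

text \<open>The value does not depend on the chosen angle and imaginary unit.\<close>

definition omega_calculus ::
  "real \<Rightarrow> real \<Rightarrow> ('v::banach, 'n::{finite,linorder}) operator
    \<Rightarrow> ('n clifford \<Rightarrow> 'n clifford) \<Rightarrow> ('v, 'n) bounded_operator" where
  "omega_calculus \<omega> \<theta> T f =
     omega_integral (SOME \<phi>. \<phi> \<in> {\<omega><..<\<theta>}) (SOME J. J \<in> imag_units) T f"

definition bnd_decomposition ::
  "real \<Rightarrow> ('n::{finite,linorder} clifford \<Rightarrow> 'n clifford) \<Rightarrow> real \<Rightarrow> real \<Rightarrow> ('n clifford \<Rightarrow> 'n clifford) \<Rightarrow> bool" where
  "bnd_decomposition \<theta> g ginf g0 gt \<longleftrightarrow> gt \<in> N0 \<theta> \<and>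
     (\<forall>s\<in>double_sector \<theta>. g s = of_real ginf + clifford_inverse (1 + s\<^sup>2) * of_real (g0 - ginf) + gt s)"

definition N_bnd :: "real \<Rightarrow> ('n::{finite,linorder} clifford \<Rightarrow> 'n clifford) set" where
  "N_bnd \<theta> = {g. \<exists>ginf g0 gt. bnd_decomposition \<theta> g ginf g0 gt}"

text \<open>
  The components are unique as functions on the double sector; outside of it the last one is
  arbitrary, and its values there do not enter the integral.
\<close>

definition extended_calculus ::
  "real \<Rightarrow> real \<Rightarrow> ('v::banach, 'n::{finite,linorder}) operator
    \<Rightarrow> ('n clifford \<Rightarrow> 'n clifford) \<Rightarrow> ('v, 'n) bounded_operator" where
  "extended_calculus \<omega> \<theta> T g =
     (let (ginf, g0, gt) = (SOME (ginf, g0, gt). bnd_decomposition \<theta> g ginf g0 gt)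
      in ginf *\<^sub>R id_blinfun + (g0 - ginf) *\<^sub>R bounded_inverse (one_plus_square T)
         + omega_calculus \<omega> \<theta> T gt)"

definition regularizer ::
  "real \<Rightarrow> real \<Rightarrow> ('v::banach, 'n::{finite,linorder}) operator
    \<Rightarrow> ('n clifford \<Rightarrow> 'n clifford) \<Rightarrow> ('n clifford \<Rightarrow> 'n clifford) \<Rightarrow> bool" where
  "regularizer \<omega> \<theta> T g e \<longleftrightarrow> e \<in> N_bnd \<theta> \<and> (\<lambda>s. e s * g s) \<in> N_bnd \<theta> \<and>
     inj (blinfun_apply (extended_calculus \<omega> \<theta> T e))"

definition N_reg ::
  "real \<Rightarrow> real \<Rightarrow> ('v::banach, 'n::{finite,linorder}) operator \<Rightarrow> ('n clifford \<Rightarrow> 'n clifford) set" where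
  "N_reg \<omega> \<theta> T = {g \<in> intrinsic (double_sector \<theta>). \<exists>e. regularizer \<omega> \<theta> T g e}"

text \<open>$e(T)^{-1} (eg)(T)$; the operator does not depend on the chosen regularizer \<^term>\<open>e\<close>.\<close>

definition Hinf_calculus ::
  "real \<Rightarrow> real \<Rightarrow> ('v::banach, 'n::{finite,linorder}) operator
    \<Rightarrow> ('n clifford \<Rightarrow> 'n clifford) \<Rightarrow> ('v, 'n) operator" where
  "Hinf_calculus \<omega> \<theta> T g =
     (let e = (SOME e. regularizer \<omega> \<theta> T g e);
          eT = blinfun_apply (extended_calculus \<omega> \<theta> T e);
          egT = blinfun_apply (extended_calculus \<omega> \<theta> T (\<lambda>s. e s * g s))
      in (\<lambda>v. if egT v \<in> range eT then Some (inv eT (egT v)) else None))"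

end

(*
  On the path of integration the contributions of s and of its conjugate add up to a combination of
  Q_s[T]^{-1} and T Q_s[T]^{-1} with real coefficients, because f is intrinsic and Q_s[T] depends
  only on the scalar part and the modulus of s.  Hence every bounded operator that commutes with these two
  operators for all s commutes with f(T), and so with g(T) = e(T)^{-1} (eg)(T) as both factors are
  of this form.  An operator that commutes with T commutes with them, which is i).  Both operators
  commute with T themselves, so by the same argument f(T) commutes with them, which is ii).
  Convergence of the integral plays no role: a divergent one has the value 0.
*)

theory Submission
  imports Defs
begin

section \<open>Paravectors and imaginary units\<close>

lemma norm_clifford_one: "norm (1 :: 'n::{finite,linorder} clifford) = 1"
  by transfer simp

lemma scalar_part_eq_inner: "scalar_part s = inner s 1"
  unfolding scalar_part_def by transfer (simp add: inner_axis)

lemma coeffs_gen_eq_inner: "coeffs s $ {i} = inner s (gen i)"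
proof -
  have "inner s (gen i) = inner (coeffs s) (axis {i} 1)"
    by (simp add: inner_clifford.rep_eq clifford_basis_def Clifford_inverse)
  then show ?thesis by (simp add: inner_axis)
qed

lemma inner_gen_gen: "inner (gen i) (gen j) = (if i = j then 1 else 0)"
proof -
  have "coeffs (gen i) $ {j} = (if i = j then 1 else 0)"
    by (simp add: clifford_basis_def Clifford_inverse axis_def)
  then show ?thesis by (simp only: coeffs_gen_eq_inner)
qed

lemma scalar_part_gen [simp]: "scalar_part (gen i) = 0"
  by (simp add: scalar_part_def clifford_basis_def Clifford_inverse axis_def)

lemma scalar_part_simps [simp]:
  fixes s t :: "'n::{finite,linorder} clifford"
  shows "scalar_part (s + t) = scalar_part s + scalar_part t"
    and "scalar_part (r *\<^sub>R s) = r * scalar_part s"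
    and "scalar_part (of_real r :: 'n clifford) = r"
  by (simp_all add: scalar_part_eq_inner inner_add_left of_real_def
      dot_square_norm norm_clifford_one)

lemma scalar_part_sum_gen [simp]: "scalar_part (\<Sum>i\<in>UNIV. x i *\<^sub>R gen i) = 0"
  by (simp add: scalar_part_eq_inner inner_sum_left scalar_part_gen[unfolded scalar_part_eq_inner])

text \<open>The generators are orthonormal and orthogonal to 1, so the coefficients at singletons
  return the \<open>x i\<close>. Conjugation thereby becomes plain algebra in \<open>s\<close> and
  its scalar part.\<close>

lemma paravector_conj_eq:
  assumes "s \<in> paravectors"
  shows "paravector_conj s = of_real (2 * scalar_part s) - s"
proof -
  obtain x0 x where s: "s = of_real x0 + (\<Sum>i\<in>UNIV. x i *\<^sub>R gen i)"
    using assms by (auto simp: paravectors_def)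
  have "inner (of_real x0) (gen i) = 0" for i :: 'a
    using scalar_part_gen[of i] by (simp add: scalar_part_eq_inner inner_commute of_real_def)
  then have "coeffs s $ {i} = x i" for i
    unfolding coeffs_gen_eq_inner s
    by (simp add: inner_add_left inner_sum_left inner_gen_gen if_distrib cong: if_cong)
  then show ?thesis
    by (simp add: paravector_conj_def) (simp add: s mult_2)
qed

lemma imag_unitE:
  assumes "J \<in> imag_units"
  obtains x where "J = (\<Sum>i\<in>UNIV. x i *\<^sub>R gen i)" "(\<Sum>i\<in>UNIV. (x i)\<^sup>2) = 1"
proof -
  obtain x0 x where J: "J = of_real x0 + (\<Sum>i\<in>UNIV. x i *\<^sub>R gen i)"
    and "scalar_part J = 0" "norm J = 1"
    using assms by (auto simp: imag_units_def paravectors_def)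
  then have [simp]: "x0 = 0" by simp
  have "(norm J)\<^sup>2 = (\<Sum>i\<in>UNIV. (x i)\<^sup>2)"
    unfolding power2_norm_eq_inner J
    by (simp add: inner_sum_left inner_sum_right inner_gen_gen power2_eq_square
        if_distrib cong: if_cong)
  with J \<open>norm J = 1\<close> show ?thesis by (intro that[of x]) simp_all
qed

text \<open>Makes the choice of an imaginary unit in \<open>omega_calculus\<close> meaningful. The
  witness is a generator; one exists because the index type is inhabited.\<close>

lemma imag_units_nonempty: "imag_units \<noteq> ({} :: 'n::{finite,linorder} clifford set)"
proof -
  fix i :: 'n
  have "gen i = of_real 0 + (\<Sum>j\<in>UNIV. (if j = i then 1 else 0) *\<^sub>R gen j)"
    by (simp add: if_distrib[where f = "\<lambda>r. r *\<^sub>R _"] cong: if_cong)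
  then have "gen i \<in> paravectors"
    unfolding paravectors_def by (intro CollectI exI conjI TrueI)
  moreover have "norm (gen i) = 1"
    by (simp add: norm_eq_sqrt_inner inner_gen_gen)
  ultimately have "gen i \<in> imag_units"
    by (simp add: imag_units_def)
  then show ?thesis by blast
qed

text \<open>Symmetrising the double sum over products of generators cancels the mixed terms by
  anticommutation. What remains are the squares of generators, weighted by squared coordinates that
  sum to 1.\<close>

lemma imag_unit_square:
  assumes "J \<in> imag_units"
  shows "J * J = -1"
proof -
  obtain x where J: "J = (\<Sum>i\<in>UNIV. x i *\<^sub>R gen i)" and x: "(\<Sum>i\<in>UNIV. (x i)\<^sup>2) = 1"
    using assms by (rule imag_unitE)
  have 1: "J * J = (\<Sum>i\<in>UNIV. \<Sum>j\<in>UNIV. (x i * x j) *\<^sub>R (gen i * gen j))"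
    unfolding J by (simp add: sum_product)
      (intro sum.cong refl arg_cong2[of _ _ _ _ scaleR] mult.commute)
  \<comment> \<open>Swapping the two summations and renaming reverses each product of
    generators.\<close>
  have 2: "J * J = (\<Sum>i\<in>UNIV. \<Sum>j\<in>UNIV. (x i * x j) *\<^sub>R (gen j * gen i))"
    unfolding 1 by (subst sum.swap)
      (intro sum.cong refl arg_cong2[of _ _ _ _ scaleR] mult.commute)
  have "gen i * gen j + gen j * gen i = (if i = j then -2 else 0)" for i j :: 'a
    using gen_anticommute[of i j] by (auto simp: gen_square)
  then have 3: "(x i * x j) *\<^sub>R (gen i * gen j) + (x i * x j) *\<^sub>R (gen j * gen i)
      = (if i = j then (x i)\<^sup>2 *\<^sub>R (-2) else 0)" for i j
    by (auto simp: scaleR_add_right[symmetric] power2_eq_square)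
  have "J * J + J * J = (\<Sum>i\<in>UNIV. \<Sum>j\<in>UNIV. if i = j then (x i)\<^sup>2 *\<^sub>R (-2) else 0)"
    unfolding 3[symmetric] sum.distrib 1[symmetric] 2[symmetric] ..
  also have "\<dots> = (\<Sum>i\<in>UNIV. (x i)\<^sup>2) *\<^sub>R (-2)"
    by (simp add: scaleR_sum_left sum_negf)
  finally have "2 *\<^sub>R (J * J) = 2 *\<^sub>R (-1)"
    unfolding x by (simp only: scaleR_2 scaleR_one) simp
  then show ?thesis
    unfolding scaleR_cancel_left by simp
qed

lemma clifford_inverse_eqI:
  assumes "a * b = 1" "b * a = 1"
  shows "clifford_inverse a = b"
  unfolding clifford_inverse_def
proof (rule the_equality)
  fix c assume c: "a * c = 1 \<and> c * a = 1"
  have "c = c * (a * b)" using assms by simp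
  also have "\<dots> = b" using c by (simp add: mult.assoc[symmetric])
  finally show "c = b" .
qed (use assms in simp)

lemma clifford_inverse_imag_unit: "J \<in> imag_units \<Longrightarrow> clifford_inverse J = - J"
  by (rule clifford_inverse_eqI) (simp_all add: imag_unit_square)

section \<open>Arithmetic in the plane C_J, a copy of the complex numbers\<close>

lemma slice_point_scaleR: "slice_point J x y = x *\<^sub>R 1 + y *\<^sub>R J"
  by (simp add: slice_point_def of_real_def)

lemma slice_point_mult:
  assumes "J \<in> imag_units"
  shows "slice_point J a b * slice_point J c d = slice_point J (a * c - b * d) (a * d + b * c)"
  unfolding slice_point_scaleR
  by (simp add: distrib_left distrib_right imag_unit_square[OF assms] scaleR_add_left
      scaleR_diff_left scaleR_add_right scaleR_diff_right mult.commute)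

lemma slice_point_add: "slice_point J a b + slice_point J c d = slice_point J (a + c) (b + d)"
  by (simp add: slice_point_scaleR algebra_simps)

lemma slice_point_of_real: "slice_point J a 0 = of_real a"
  by (simp add: slice_point_def)

lemma scaleR_slice_point: "r *\<^sub>R slice_point J a b = slice_point J (r * a) (r * b)"
  by (simp add: slice_point_scaleR algebra_simps)

text \<open>1 and \<open>J\<close> are orthonormal, so scalar part, norm and conjugate are those of
  the complex number x + iy.\<close>

lemma slice_point_imag_unit:
  assumes "J \<in> imag_units"
  shows "scalar_part (slice_point J x y) = x"
    and "(norm (slice_point J x y))\<^sup>2 = x\<^sup>2 + y\<^sup>2"
    and "slice_point J x y \<in> paravectors"
    and "paravector_conj (slice_point J x y) = slice_point J x (- y)"
proof -
  have J: "scalar_part J = 0" "norm J = 1"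
    using assms by (auto simp: imag_units_def)
  then have J1: "inner J 1 = 0" "inner 1 J = 0" "inner J J = 1" "inner 1 (1 :: 'a clifford) = 1"
    by (simp_all add: scalar_part_eq_inner inner_commute dot_square_norm norm_clifford_one)
  show x: "scalar_part (slice_point J x y) = x"
    by (simp add: slice_point_scaleR scalar_part_eq_inner inner_add_left J1)
  show "(norm (slice_point J x y))\<^sup>2 = x\<^sup>2 + y\<^sup>2"
    unfolding slice_point_scaleR power2_norm_eq_inner
    by (simp add: inner_add_left inner_add_right J1 power2_eq_square)
  obtain z where "J = (\<Sum>i\<in>UNIV. z i *\<^sub>R gen i)"
    using assms by (rule imag_unitE)
  then have "slice_point J x y = of_real x + (\<Sum>i\<in>UNIV. (y * z i) *\<^sub>R gen i)"
    by (simp add: slice_point_scaleR scaleR_sum_right of_real_def)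
  then show p: "slice_point J x y \<in> paravectors"
    unfolding paravectors_def by (intro CollectI exI conjI TrueI)
  show "paravector_conj (slice_point J x y) = slice_point J x (- y)"
    using slice_point_add[of J x "- y" x y]
    by (simp add: paravector_conj_eq[OF p] x slice_point_of_real[symmetric, of _ J] diff_eq_eq)
qed

lemma exp_unit_imag_unit:
  assumes "J \<in> imag_units"
  shows "scalar_part (r *\<^sub>R exp_unit J \<phi>) = r * cos \<phi>"
    and "norm (r *\<^sub>R exp_unit J \<phi>) = \<bar>r\<bar>"
    and "r *\<^sub>R exp_unit J \<phi> \<in> paravectors"
proof -
  have "(norm (exp_unit J \<phi>))\<^sup>2 = 1"
    by (simp add: exp_unit_def slice_point_imag_unit[OF assms])
  then have "norm (exp_unit J \<phi>) = 1"
    by (metis abs_norm_cancel power2_eq_1_iff abs_1 abs_minus_cancel)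
  then show "norm (r *\<^sub>R exp_unit J \<phi>) = \<bar>r\<bar>" by simp
  show "scalar_part (r *\<^sub>R exp_unit J \<phi>) = r * cos \<phi>"
    by (simp add: exp_unit_def slice_point_imag_unit[OF assms])
  show "r *\<^sub>R exp_unit J \<phi> \<in> paravectors"
    unfolding exp_unit_def scaleR_slice_point by (rule slice_point_imag_unit[OF assms])
qed

section \<open>Double sectors and their boundary\<close>

text \<open>The absolute value treats both halves of the double sector at once: a shift by pi only
  changes the sign of the cosine.\<close>

lemma cos_less_abs_cos_of_sector_angles:
  assumes "\<psi> \<in> sector_angles \<omega>" "\<omega> < pi / 2"
  shows "cos \<omega> < \<bar>cos \<psi>\<bar>"
proof -
  have *: "cos \<omega> < cos \<alpha>" if "\<bar>\<alpha>\<bar> < \<omega>" for \<alpha>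
    using cos_monotone_0_pi[of "\<bar>\<alpha>\<bar>" \<omega>] that assms(2) by (auto simp: abs_if split: if_splits)
  from assms(1) consider "\<bar>\<psi>\<bar> < \<omega>" | "\<bar>\<psi> - pi\<bar> < \<omega>"
    by (auto simp: sector_angles_def abs_if)
  then show ?thesis
  proof cases
    case 1
    then show ?thesis using *[of \<psi>] by linarith
  next
    case 2
    then show ?thesis using *[of "\<psi> - pi"] by (simp add: cos_diff)
  qed
qed

text \<open>Used in contrapositive form: violating this inequality puts a point outside the sector
  without any comparison of angles.\<close>

lemma double_sector_imp_scalar_part:
  assumes "s \<in> double_sector \<omega>" "\<omega> < pi / 2"
  shows "cos \<omega> * norm s < \<bar>scalar_part s\<bar>"
proof -
  obtain r J \<psi> where s: "s = r *\<^sub>R exp_unit J \<psi>" and r: "r > 0"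
    and J: "J \<in> imag_units" and \<psi>: "\<psi> \<in> sector_angles \<omega>"
    using assms(1) by (auto simp: double_sector_def)
  show ?thesis
    unfolding s exp_unit_imag_unit[OF J] abs_mult
    using r cos_less_abs_cos_of_sector_angles[OF \<psi> assms(2)] by simp
qed

text \<open>The weak inequality cuts out a closed set that contains the sector.\<close>

lemma closure_double_sector_imp_scalar_part:
  assumes "s \<in> closure (double_sector \<omega>)" "\<omega> < pi / 2"
  shows "cos \<omega> * norm s \<le> \<bar>scalar_part s\<bar>"
proof -
  have "closed {s. cos \<omega> * norm s \<le> \<bar>scalar_part (s :: 'a clifford)\<bar>}"
    unfolding scalar_part_eq_inner by (intro closed_Collect_le continuous_intros)
  moreover have "double_sector \<omega> \<subseteq> {s. cos \<omega> * norm s \<le> \<bar>scalar_part (s :: 'a clifford)\<bar>}"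
    using double_sector_imp_scalar_part[OF _ assms(2)] by (auto intro: less_imp_le)
  ultimately show ?thesis
    using closure_minimal assms(1) by blast
qed

text \<open>Cosine is even and |t| sgn t = t. In these coordinates, replacing \<open>t\<close> by
  \<open>- t\<close> is conjugation, the symmetry on which the cancellation in the integral
  rests.\<close>

lemma sector_path_slice_point:
  assumes "\<sigma> = 1 \<or> \<sigma> = -1"
  shows "sector_path \<phi> J \<sigma> t = slice_point J (\<sigma> * \<bar>t\<bar> * cos \<phi>) (- \<sigma> * t * sin \<phi>)"
  by (auto simp: sector_path_def exp_unit_def scaleR_slice_point sgn_if)

text \<open>On the open half line containing \<open>t\<close> the sign is constant, so the path is
  linear there.\<close>

lemma has_vector_derivative_sector_path:
  assumes "t \<noteq> 0"
  shows "(sector_path \<phi> J \<sigma> has_vector_derivative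
           slice_point J (\<sigma> * sgn t * cos \<phi>) (- \<sigma> * sin \<phi>)) (at t)"
proof -
  let ?E = "exp_unit J (- sgn t * \<phi>)"
  have "((\<lambda>u. (\<sigma> * sgn t * u) *\<^sub>R ?E) has_vector_derivative (\<sigma> * sgn t) *\<^sub>R ?E) (at t)"
    by (auto intro!: derivative_eq_intros)
  moreover have "(\<sigma> * sgn t) *\<^sub>R ?E = slice_point J (\<sigma> * sgn t * cos \<phi>) (- \<sigma> * sin \<phi>)"
    using assms by (auto simp: exp_unit_def scaleR_slice_point sgn_if)
  moreover have "(\<sigma> * sgn t * u) *\<^sub>R ?E = sector_path \<phi> J \<sigma> u" if "u \<in> {u. t * u > 0}" for u
  proof -
    have "sgn u = sgn t"
      using that assms by (auto simp: sgn_if zero_less_mult_iff)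
    moreover have "\<bar>u\<bar> = sgn u * u" by (simp add: sgn_if)
    ultimately show ?thesis by (simp add: sector_path_def mult.assoc)
  qed
  moreover have "open {u. t * u > 0}"
    by (intro open_Collect_less continuous_intros)
  moreover have "t \<in> {u. t * u > 0}"
    using assms by (simp add: zero_less_mult_iff) linarith
  ultimately show ?thesis
    using has_vector_derivative_transform_within_open[of "\<lambda>u. (\<sigma> * sgn t * u) *\<^sub>R ?E"
        "(\<sigma> * sgn t) *\<^sub>R ?E" t "{u. t * u > 0}" "sector_path \<phi> J \<sigma>"] by simp
qed

lemma exp_unit_add_pi: "- (r *\<^sub>R exp_unit J \<psi>) = r *\<^sub>R exp_unit J (\<psi> + pi)"
  by (simp add: exp_unit_def scaleR_slice_point) (simp add: slice_point_scaleR)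

lemma sector_path_mem_double_sector:
  assumes "\<sigma> = 1 \<or> \<sigma> = -1" "\<bar>\<phi>\<bar> < \<theta>" "t \<noteq> 0" "J \<in> imag_units"
  shows "sector_path \<phi> J \<sigma> t \<in> double_sector \<theta>"
proof -
  \<comment> \<open>\<open>double_sector\<close> asks for a positive radius, so the sign -1 is
    absorbed as a rotation by pi.\<close>
  have "sector_path \<phi> J \<sigma> t = \<bar>t\<bar> *\<^sub>R exp_unit J (- sgn t * \<phi> + (if \<sigma> = 1 then 0 else pi))"
    using assms(1) exp_unit_add_pi[of "\<bar>t\<bar>" J "- sgn t * \<phi>"] by (auto simp: sector_path_def)
  moreover have "- sgn t * \<phi> + (if \<sigma> = 1 then 0 else pi) \<in> sector_angles \<theta>"
    using assms(2) by (auto simp: sector_angles_def sgn_if)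
  ultimately show ?thesis
    using assms(3,4) unfolding double_sector_def by force
qed

section \<open>The Clifford action on the module\<close>

lemma lmult_mult: "lmult (a * b) v = lmult a (lmult b v)"
  by (simp add: lmult_def times_clifford.rep_eq twisted_left_assoc)

lemma lmult_add: "lmult (a + b) v = lmult a v + lmult b v"
  by (simp add: lmult_def plus_clifford.rep_eq twisted_left_add_left)

lemma lmult_of_real: "lmult (of_real r) v = r *\<^sub>R v"
  by (simp add: lmult_def of_real_def scaleR_clifford.rep_eq one_clifford.rep_eq
      twisted_left_scaleR_left twisted_left_one)

lemma twisted_right_scaleR_right: "twisted_right v (r *\<^sub>R a) = r *\<^sub>R twisted_right v a"
  by (simp add: vec_eq_iff twisted_right_nth scaleR_sum_right mult_ac)

lemma rmult_of_real: "rmult v (of_real r) = r *\<^sub>R v"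
  by (simp add: rmult_def of_real_def scaleR_clifford.rep_eq one_clifford.rep_eq
      twisted_right_scaleR_right twisted_right_one)

lemma bounded_linear_axis: "bounded_linear (axis i :: 'v::real_normed_vector \<Rightarrow> 'v ^ 'n::finite)"
proof (rule bounded_linear_intro[where K = 1])
  show "axis i (x + y) = axis i x + (axis i y :: 'v ^ 'n)" for x y :: 'v
    by (simp add: vec_eq_iff axis_def)
  show "axis i (r *\<^sub>R x) = r *\<^sub>R (axis i x :: 'v ^ 'n)" for r and x :: 'v
    by (simp add: vec_eq_iff axis_def)
  show "norm (axis i x :: 'v ^ 'n) \<le> norm x * 1" for x :: 'v
  proof -
    have "(\<Sum>j\<in>UNIV. (norm ((axis i x :: 'v ^ 'n) $ j))\<^sup>2) = (\<Sum>j\<in>UNIV. if j = i then (norm x)\<^sup>2 else 0)"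
      by (rule sum.cong) (auto simp: axis_def)
    then show ?thesis by (simp add: norm_vec_def L2_set_def)
  qed
qed

text \<open>A finite sum of coordinate projections, scalings and coordinate embeddings, each
  bounded.\<close>

lemma bounded_linear_lmult:
  "bounded_linear (lmult a :: ('v::real_normed_vector, 'n::{finite,linorder}) cmodule \<Rightarrow> _)"
proof -
  have "bounded_linear (\<lambda>v :: ('v, 'n) cmodule. \<Sum>A\<in>UNIV. \<Sum>B\<in>UNIV.
      axis (sym_diff A B) ((clifford_sign A B * coeffs a $ A) *\<^sub>R v $ B))"
    by (intro bounded_linear_sum bounded_linear_compose[OF bounded_linear_axis]
        bounded_linear_compose[OF bounded_linear_scaleR_right] bounded_linear_vec_nth)
  then show ?thesis
    by (simp add: lmult_def[abs_def] twisted_left_def)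
qed

section \<open>Integrals over the real line\<close>

text \<open>The whole line is not a compact interval, so only the limit clause of the
  Henstock-Kurzweil definition remains.\<close>

lemma has_integral_UNIV_real_iff:
  fixes f :: "real \<Rightarrow> 'b::real_normed_vector"
  shows "(f has_integral I) UNIV \<longleftrightarrow> (\<forall>e>0. \<exists>B>0. \<forall>a b. ball 0 B \<subseteq> cbox a b \<longrightarrow>
           (\<exists>z. (f has_integral z) (cbox a b) \<and> norm (z - I) < e))"
proof -
  have "\<not> (\<exists>a b. (UNIV :: real set) = cbox a b)"
    using not_interval_UNIV by simp
  then show ?thesis
    by (subst has_integral_alt) simp
qed

text \<open>Balls around 0 are symmetric: an interval containing one reflects to another that
  contains it, and reflection on compact intervals applies.\<close>

lemma has_integral_reflect_UNIV:
  fixes f :: "real \<Rightarrow> 'b::real_normed_vector"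
  assumes "(f has_integral I) UNIV"
  shows "((\<lambda>x. f (- x)) has_integral I) UNIV"
  unfolding has_integral_UNIV_real_iff
proof (intro allI impI)
  fix e :: real assume "e > 0"
  then obtain B where "B > 0" and B: "\<And>a b. ball 0 B \<subseteq> cbox a b \<Longrightarrow>
      \<exists>z. (f has_integral z) (cbox a b) \<and> norm (z - I) < e"
    using assms[unfolded has_integral_UNIV_real_iff] by meson
  have "\<exists>z. ((\<lambda>x. f (- x)) has_integral z) (cbox a b) \<and> norm (z - I) < e"
    if *: "ball 0 B \<subseteq> cbox a b" for a b
  proof -
    have "ball 0 B \<subseteq> cbox (- b) (- a)"
    proof
      fix x :: real assume "x \<in> ball 0 B"
      then have "- x \<in> cbox a b" using * by (intro subsetD[OF *]) simp
      then show "x \<in> cbox (- b) (- a)" by simp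
    qed
    then obtain z where "(f has_integral z) (cbox (- b) (- a))" "norm (z - I) < e"
      using B by blast
    then show ?thesis
      using has_integral_reflect_lemma[of f z "- b" "- a"] by auto
  qed
  with \<open>B > 0\<close> show "\<exists>B>0. \<forall>a b. ball 0 B \<subseteq> cbox a b \<longrightarrow>
      (\<exists>z. ((\<lambda>x. f (- x)) has_integral z) (cbox a b) \<and> norm (z - I) < e)"
    by blast
qed

text \<open>Integrating \<open>f x + f (- x)\<close> yields twice \<open>I\<close>, yet this sum
  vanishes off one point. That point is exempt because the path of integration has its corner
  there.\<close>

lemma has_integral_odd_eq_0:
  fixes f :: "real \<Rightarrow> 'b::real_normed_vector"
  assumes "(f has_integral I) UNIV" "\<And>x. x \<noteq> 0 \<Longrightarrow> f x + f (- x) = 0"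
  shows "I = 0"
proof -
  have "((\<lambda>x. f x + f (- x)) has_integral I + I) UNIV"
    by (intro has_integral_add assms(1) has_integral_reflect_UNIV)
  then have "((\<lambda>x :: real. 0 :: 'b) has_integral I + I) UNIV"
    using assms(2) by (intro has_integral_spike_finite[of "{0}" UNIV "\<lambda>x. 0" "\<lambda>x. f x + f (- x)"]) auto
  then have "I + I = 0"
    by (rule has_integral_unique[OF has_integral_0, symmetric])
  then show ?thesis
    by (metis scaleR_2 scaleR_eq_0_iff zero_neq_numeral)
qed


section \<open>Resolvents and commuting operators\<close>

lemma closed_operators_add:
  assumes "T \<in> closed_operators" "T v = Some a" "T w = Some b"
  shows "T (v + w) = Some (a + b)"
proof -
  have "T (v + w) = Some (the (T v) + the (T w))"
    using assms by (auto simp: closed_operators_def dom_def)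
  then show ?thesis
    using assms(2,3) by simp
qed

lemma closed_operators_scaleR:
  assumes "T \<in> closed_operators" "T v = Some a"
  shows "T (r *\<^sub>R v) = Some (r *\<^sub>R a)"
proof -
  \<comment> \<open>Real homogeneity is right linearity at real Clifford numbers.\<close>
  have "T (rmult v (of_real r)) = Some (rmult (the (T v)) (of_real r))"
    using assms by (auto simp: closed_operators_def dom_def)
  then show ?thesis
    using assms(2) by (simp add: rmult_of_real)
qed

text \<open>The graph of an inverse is the converse of the graph of \<open>A\<close>, so the inverse
  is unique and the definite description denotes it.\<close>

lemma bounded_inverse_eq_Some_iff:
  assumes "is_bounded_inverse A R"
  shows "A w = Some u \<longleftrightarrow> blinfun_apply (bounded_inverse A) u = w"
proof -
  have iff: "A w = Some u \<longleftrightarrow> blinfun_apply R' u = w" if "is_bounded_inverse A R'" for R' w u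
  proof -
    have "(u, w) \<in> Map.graph (total_op R') \<longleftrightarrow> (u, w) \<in> (Map.graph A)\<inverse>"
      using that by (simp add: is_bounded_inverse_def)
    then show ?thesis by (auto simp: graph_def total_op_def)
  qed
  have "R' = R" if "is_bounded_inverse A R'" for R'
    by (rule blinfun_eqI) (metis iff[OF that] iff[OF assms])
  then have "bounded_inverse A = R"
    unfolding bounded_inverse_def using assms by blast
  then show ?thesis using iff[OF assms] by simp
qed

lemma Q_op_eq_Some_iff:
  "Q_op s T w = Some u \<longleftrightarrow>
     (\<exists>a b. T w = Some a \<and> T a = Some b \<and> u = b - (2 * scalar_part s) *\<^sub>R a + (norm s)\<^sup>2 *\<^sub>R w)"
  unfolding Q_op_def by (cases "T w"; cases "T (the (T w))") (auto simp: dom_def map_comp_def)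

abbreviation Q_inv ::
  "'n clifford \<Rightarrow> ('v::real_normed_vector, 'n::{finite,linorder}) operator \<Rightarrow> ('v, 'n) bounded_operator" where
  "Q_inv s T \<equiv> bounded_inverse (Q_op s T)"

text \<open>For \<open>s\<close> in the S-resolvent set the range of \<open>Q_inv s T\<close> lies
  in the domain of T^2, so \<open>the\<close> meets a genuine value.\<close>

definition T_Q_inv ::
  "'n clifford \<Rightarrow> ('v::real_normed_vector, 'n::{finite,linorder}) operator
    \<Rightarrow> ('v, 'n) cmodule \<Rightarrow> ('v, 'n) cmodule" where
  "T_Q_inv s T v = the (T (blinfun_apply (Q_inv s T) v))"

lemma Q_inv_eq_iff:
  assumes "s \<in> S_resolvent_set T"
  shows "blinfun_apply (Q_inv s T) u = w \<longleftrightarrow> Q_op s T w = Some u"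
  using assms bounded_inverse_eq_Some_iff by (fastforce simp: S_resolvent_set_def)

text \<open>The second equation is the identity Q_s[T] Q_s[T]^{-1} u = u solved for the T^2
  term.\<close>

lemma Q_inv_in_dom:
  assumes "s \<in> S_resolvent_set T"
  shows "T (blinfun_apply (Q_inv s T) u) = Some (T_Q_inv s T u)"
    and "T (T_Q_inv s T u)
         = Some (u + (2 * scalar_part s) *\<^sub>R T_Q_inv s T u - (norm s)\<^sup>2 *\<^sub>R blinfun_apply (Q_inv s T) u)"
proof -
  have "Q_op s T (blinfun_apply (Q_inv s T) u) = Some u"
    using Q_inv_eq_iff[OF assms] by blast
  then obtain a b where "T (blinfun_apply (Q_inv s T) u) = Some a" "T a = Some b"
    "u = b - (2 * scalar_part s) *\<^sub>R a + (norm s)\<^sup>2 *\<^sub>R blinfun_apply (Q_inv s T) u"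
    unfolding Q_op_eq_Some_iff by blast
  then show "T (blinfun_apply (Q_inv s T) u) = Some (T_Q_inv s T u)"
    and "T (T_Q_inv s T u)
         = Some (u + (2 * scalar_part s) *\<^sub>R T_Q_inv s T u - (norm s)\<^sup>2 *\<^sub>R blinfun_apply (Q_inv s T) u)"
    by (simp_all add: T_Q_inv_def algebra_simps)
qed

section \<open>Operators commuting with T and with its resolvents\<close>

definition commutes_with ::
  "('v::real_normed_vector, 'n::{finite,linorder}) bounded_operator \<Rightarrow> ('v, 'n) operator \<Rightarrow> bool" where
  "commutes_with B T \<longleftrightarrow> (\<forall>w u. T w = Some u \<longrightarrow> T (blinfun_apply B w) = Some (blinfun_apply B u))"

lemma total_op_comp_le_iff_commutes_with:
  "total_op B \<circ>\<^sub>m T \<subseteq>\<^sub>m T \<circ>\<^sub>m total_op B \<longleftrightarrow> commutes_with B T"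
  unfolding map_le_def commutes_with_def total_op_def map_comp_def dom_def
  by (auto split: option.splits)

text \<open>Two applications of the hypothesis carry \<open>B\<close> through T and T^2, so
  \<open>B\<close> applied to Q_s[T]^{-1} v is a preimage of \<open>B v\<close> under Q_s[T];
  preimages are unique.\<close>

lemma commutes_with_resolvent:
  assumes "commutes_with B T" "s \<in> S_resolvent_set T"
  shows "blinfun_apply (Q_inv s T) (blinfun_apply B v) = blinfun_apply B (blinfun_apply (Q_inv s T) v)"
    and "T_Q_inv s T (blinfun_apply B v) = blinfun_apply B (T_Q_inv s T v)"
proof -
  let ?w = "blinfun_apply (Q_inv s T) v"
  have 1: "T (blinfun_apply B ?w) = Some (blinfun_apply B (T_Q_inv s T v))"
    using assms(1) Q_inv_in_dom(1)[OF assms(2)] by (simp add: commutes_with_def)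
  have 2: "T (blinfun_apply B (T_Q_inv s T v)) = Some (blinfun_apply B
      (v + (2 * scalar_part s) *\<^sub>R T_Q_inv s T v - (norm s)\<^sup>2 *\<^sub>R ?w))"
    using assms(1) Q_inv_in_dom(2)[OF assms(2)] by (simp add: commutes_with_def)
  have "Q_op s T (blinfun_apply B ?w) = Some (blinfun_apply B v)"
    unfolding Q_op_eq_Some_iff using 1 2 by (simp add: blinfun.bilinear_simps)
  then show 3: "blinfun_apply (Q_inv s T) (blinfun_apply B v) = blinfun_apply B ?w"
    using Q_inv_eq_iff[OF assms(2)] by blast
  show "T_Q_inv s T (blinfun_apply B v) = blinfun_apply B (T_Q_inv s T v)"
    using 1 by (simp add: T_Q_inv_def 3)
qed

text \<open>It suffices that T Q_s[T]^{-1} w is the solution x of Q_s[T] x = u.\<close>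

lemma Q_inv_commutes_with:
  assumes T: "T \<in> closed_operators" and s: "s \<in> S_resolvent_set T" and w: "T w = Some u"
  shows "blinfun_apply (Q_inv s T) u = T_Q_inv s T w"
proof -
  let ?R = "blinfun_apply (Q_inv s T)" and ?A = "T_Q_inv s T w"
  let ?b = "w + (2 * scalar_part s) *\<^sub>R ?A - (norm s)\<^sup>2 *\<^sub>R ?R w"
  note dom = Q_inv_in_dom[OF s, of w]
  \<comment> \<open>\<open>?b\<close> is the image of \<open>?A\<close> under T. Being a combination
    of three vectors of the domain, it lies there too, which puts \<open>?A\<close> in the domain of
    T^2.\<close>
  have "T (w + (2 * scalar_part s) *\<^sub>R ?A + (- (norm s)\<^sup>2) *\<^sub>R ?R w)
      = Some (u + (2 * scalar_part s) *\<^sub>R ?b + (- (norm s)\<^sup>2) *\<^sub>R ?A)"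
    by (intro closed_operators_add[OF T] closed_operators_scaleR[OF T] w dom)
  then have "T ?b = Some (u + (2 * scalar_part s) *\<^sub>R ?b - (norm s)\<^sup>2 *\<^sub>R ?A)"
    by simp
  then have "Q_op s T ?A = Some u"
    unfolding Q_op_eq_Some_iff using dom(2) by simp
  then show ?thesis
    using Q_inv_eq_iff[OF s] by blast
qed

text \<open>
  Boundedness of the S-resolvent makes $T Q_s[T]^{-1}$ a bounded operator without an appeal to the
  closed graph theorem.
\<close>

definition bounded_resolvent_set ::
  "('v::real_normed_vector, 'n::{finite,linorder}) operator \<Rightarrow> 'n clifford set" where
  "bounded_resolvent_set T = {s \<in> S_resolvent_set T. bounded_linear (S_L_inv s T)}"

text \<open>Stated for Q_s[T]^{-1} and T Q_s[T]^{-1} instead of the S-resolvent, which contains a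
  left multiplication that \<open>B\<close> need not respect. Both the \<open>B\<close> of i) and
  the f(T) of ii) have this property.\<close>

definition commutes_with_resolvents ::
  "('v::real_normed_vector, 'n::{finite,linorder}) bounded_operator \<Rightarrow> ('v, 'n) operator \<Rightarrow> bool" where
  "commutes_with_resolvents B T \<longleftrightarrow> (\<forall>s\<in>bounded_resolvent_set T. \<forall>v.
     blinfun_apply (Q_inv s T) (blinfun_apply B v) = blinfun_apply B (blinfun_apply (Q_inv s T) v) \<and>
     T_Q_inv s T (blinfun_apply B v) = blinfun_apply B (T_Q_inv s T v))"

lemma commutes_with_imp_resolvents: "commutes_with B T \<Longrightarrow> commutes_with_resolvents B T"
  by (simp add: commutes_with_resolvents_def bounded_resolvent_set_def commutes_with_resolvent)

lemma S_L_inv_eq: "S_L_inv s T v = blinfun_apply (Q_inv s T) (lmult (paravector_conj s) v) - T_Q_inv s T v"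
  by (simp add: S_L_inv_def T_Q_inv_def)

text \<open>Solve the defining formula of the S-resolvent for T Q_s[T]^{-1}; the other two terms are
  bounded.\<close>

lemma bounded_linear_T_Q_inv:
  assumes "s \<in> bounded_resolvent_set T"
  shows "bounded_linear (T_Q_inv s T)"
proof -
  have "bounded_linear (\<lambda>v. blinfun_apply (Q_inv s T) (lmult (paravector_conj s) v) - S_L_inv s T v)"
    using assms by (intro bounded_linear_sub bounded_linear_compose[OF blinfun.bounded_linear_right]
        bounded_linear_lmult) (simp add: bounded_resolvent_set_def)
  then show ?thesis by (simp add: S_L_inv_eq)
qed

lemma resolvents_commute_with:
  assumes T: "T \<in> closed_operators" and s: "s \<in> bounded_resolvent_set T"
  shows "commutes_with (Q_inv s T) T" "commutes_with (Blinfun (T_Q_inv s T)) T"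
proof -
  have s': "s \<in> S_resolvent_set T"
    using s by (simp add: bounded_resolvent_set_def)
  note R = Q_inv_commutes_with[OF T s']
  show "commutes_with (Q_inv s T) T"
    unfolding commutes_with_def using R Q_inv_in_dom(1)[OF s'] by metis
  show "commutes_with (Blinfun (T_Q_inv s T)) T"
    unfolding commutes_with_def bounded_linear_Blinfun_apply[OF bounded_linear_T_Q_inv[OF s]]
    \<comment> \<open>For T w = u, T Q_s[T]^{-1} w equals Q_s[T]^{-1} u, which T maps to T
      Q_s[T]^{-1} u.\<close>
    by (metis R Q_inv_in_dom(1)[OF s'])
qed

text \<open>A bicommutant argument: the two resolvent operators commute with T, hence are themselves
  admissible as \<open>C\<close>.\<close>

lemma commutes_with_resolventsI:
  assumes T: "T \<in> closed_operators"
    and B: "\<And>C v. commutes_with_resolvents C T \<Longrightarrow>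
              blinfun_apply C (blinfun_apply B v) = blinfun_apply B (blinfun_apply C v)"
  shows "commutes_with_resolvents B T"
  unfolding commutes_with_resolvents_def
proof (intro ballI allI conjI)
  fix s :: "'b clifford" and v
  assume s: "s \<in> bounded_resolvent_set T"
  note C = resolvents_commute_with[OF T s, THEN commutes_with_imp_resolvents]
  show "blinfun_apply (Q_inv s T) (blinfun_apply B v) = blinfun_apply B (blinfun_apply (Q_inv s T) v)"
    by (rule B[OF C(1)])
  show "T_Q_inv s T (blinfun_apply B v) = blinfun_apply B (T_Q_inv s T v)"
    using B[OF C(2)] by (simp add: bounded_linear_Blinfun_apply[OF bounded_linear_T_Q_inv[OF s]])
qed

text \<open>The gap between cos \<phi> and cos \<omega> keeps \<open>s\<close> off the closure of
  the smaller sector, hence off the spectrum. Lying outside the larger sector gives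
  boundedness.\<close>

lemma bisectorial_bounded_resolvent_set:
  assumes "bisectorial \<omega> T" "0 < \<omega>" "\<omega> < \<phi>" "\<phi> < pi / 2"
    and s: "s \<in> paravectors" "s \<noteq> 0" "\<bar>scalar_part s\<bar> \<le> cos \<phi> * norm s"
  shows "s \<in> bounded_resolvent_set T"
proof -
  have "cos \<phi> < cos \<omega>"
    using assms by (intro cos_monotone_0_pi) auto
  then have "cos \<phi> * norm s < cos \<omega> * norm s"
    using s(2) by simp
  then have "s \<notin> closure (double_sector \<omega>)"
    using closure_double_sector_imp_scalar_part[of s \<omega>] s(3) assms(3,4) by auto
  then have "s \<in> S_resolvent_set T"
    using assms(1) s(1) by (auto simp: bisectorial_def S_spectrum_def)
  moreover have "s \<notin> double_sector \<phi>"
    using double_sector_imp_scalar_part[of s \<phi>] s(3) assms(4) by auto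
  then have "bounded_linear (S_L_inv s T)"
    using assms s by (auto simp: bisectorial_def)
  ultimately show ?thesis by (simp add: bounded_resolvent_set_def)
qed

section \<open>The functional calculi\<close>

text \<open>
  Adding the contributions of $s$ and $\overline{s}$ removes the imaginary unit, with which a
  right-linear operator need not commute.
\<close>

lemma S_L_inv_conj_sum:
  assumes J: "J \<in> imag_units" and s: "slice_point J x y \<in> bounded_resolvent_set T"
  shows "S_L_inv (slice_point J x y) T (lmult (slice_point J a b) v)
         + S_L_inv (slice_point J x (- y)) T (lmult (slice_point J a (- b)) v)
       = (2 * (x * a + y * b)) *\<^sub>R blinfun_apply (Q_inv (slice_point J x y) T) v
         - (2 * a) *\<^sub>R T_Q_inv (slice_point J x y) T v"
proof -
  let ?s = "slice_point J x y" and ?c = "slice_point J a b"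
  let ?s' = "slice_point J x (- y)" and ?c' = "slice_point J a (- b)"
  let ?R = "blinfun_apply (Q_inv ?s T)"
  interpret TR: bounded_linear "T_Q_inv ?s T"
    by (rule bounded_linear_T_Q_inv[OF s])
  have Q: "Q_op ?s' T = Q_op ?s T"
    unfolding Q_op_def slice_point_imag_unit[OF J] power2_minus ..
  have TQ: "T_Q_inv ?s' T = T_Q_inv ?s T"
    unfolding T_Q_inv_def Q by simp
  \<comment> \<open>The two products are conjugate, so their sum is twice the real part.\<close>
  have "?s' * ?c + ?s * ?c' = of_real (2 * (x * a + y * b))"
    unfolding slice_point_mult[OF J] slice_point_add slice_point_of_real[of J, symmetric]
    by (simp add: algebra_simps)
  then have 1: "lmult ?s' (lmult ?c v) + lmult ?s (lmult ?c' v) = (2 * (x * a + y * b)) *\<^sub>R v"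
    by (simp only: lmult_mult[symmetric] lmult_add[symmetric] lmult_of_real)
  have "?c + ?c' = of_real (2 * a)"
    unfolding slice_point_add slice_point_of_real[of J, symmetric] by simp
  then have 2: "lmult ?c v + lmult ?c' v = (2 * a) *\<^sub>R v"
    by (simp only: lmult_add[symmetric] lmult_of_real)
  have "S_L_inv ?s T (lmult ?c v) + S_L_inv ?s' T (lmult ?c' v)
      = ?R (lmult ?s' (lmult ?c v) + lmult ?s (lmult ?c' v)) - T_Q_inv ?s T (lmult ?c v + lmult ?c' v)"
    unfolding S_L_inv_eq Q TQ slice_point_imag_unit[OF J] TR.add blinfun.add_right by simp
  then show ?thesis
    unfolding 1 2 TR.scaleR blinfun.scaleR_right .
qed

text \<open>On the boundary of the sector the required bound on the scalar part holds with
  equality.\<close>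

lemma sector_path_bounded_resolvent_set:
  assumes T: "bisectorial \<omega> T" and \<omega>: "0 < \<omega>" "\<omega> < \<phi>" "\<phi> < pi / 2"
    and J: "J \<in> imag_units" and \<sigma>: "\<sigma> = 1 \<or> \<sigma> = -1" and t: "t \<noteq> 0"
  shows "sector_path \<phi> J \<sigma> t \<in> bounded_resolvent_set T"
proof (rule bisectorial_bounded_resolvent_set[OF T \<omega>])
  let ?s = "sector_path \<phi> J \<sigma> t"
  have n: "norm ?s = \<bar>t\<bar>"
    unfolding sector_path_def exp_unit_imag_unit[OF J] using \<sigma> by auto
  then show "?s \<noteq> 0" using t by auto
  show "?s \<in> paravectors"
    unfolding sector_path_def by (rule exp_unit_imag_unit[OF J])
  have "cos \<phi> \<ge> 0"
    using \<omega> by (intro cos_ge_zero) auto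
  then show "\<bar>scalar_part ?s\<bar> \<le> cos \<phi> * norm ?s"
    unfolding n unfolding sector_path_slice_point[OF \<sigma>] slice_point_imag_unit[OF J]
    using \<sigma> by (auto simp: abs_mult)
qed

text \<open>The parameters \<open>t\<close> and \<open>- t\<close> give conjugate points, and the
  parity of the real components turns this into conjugate values.\<close>

lemma intrinsic_on_sector_path:
  assumes f: "f \<in> intrinsic (double_sector \<theta>)" and J: "J \<in> imag_units"
    and \<sigma>: "\<sigma> = 1 \<or> \<sigma> = -1" and \<phi>: "\<bar>\<phi>\<bar> < \<theta>" and t: "t \<noteq> 0"
  obtains p q where "f (sector_path \<phi> J \<sigma> t) = slice_point J p q"
    and "f (sector_path \<phi> J \<sigma> (- t)) = slice_point J p (- q)"
proof -
  define x y where "x = \<sigma> * \<bar>t\<bar> * cos \<phi>" and "y = - \<sigma> * t * sin \<phi>"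
  obtain f0 f1 where f: "slice_components (double_sector \<theta>) f f0 f1"
    and real: "\<forall>z\<in>slice_params (double_sector \<theta> :: 'a clifford set). f0 z \<in> \<real> \<and> f1 z \<in> \<real>"
    using f by (auto simp: intrinsic_def)
  have path: "sector_path \<phi> I \<sigma> t = slice_point I x y" "sector_path \<phi> I \<sigma> (- t) = slice_point I x (- y)"
    for I :: "'a clifford"
    by (simp_all add: sector_path_slice_point[OF \<sigma>] x_def y_def)
  \<comment> \<open>\<open>slice_params\<close> asks for the point on every slice, hence
    \<open>path\<close> for arbitrary \<open>I\<close>.\<close>
  have mem: "(x, y) \<in> slice_params (double_sector \<theta> :: 'a clifford set)"
    "(x, - y) \<in> slice_params (double_sector \<theta> :: 'a clifford set)"
    using t by (auto simp: slice_params_def path[symmetric] intro!: sector_path_mem_double_sector[OF \<sigma> \<phi>])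
  obtain p q where "f0 (x, y) = of_real p" "f1 (x, y) = of_real q"
    using real mem(1) by (auto elim!: Reals_cases)
  moreover have "f0 (x, - y) = f0 (x, y)" "f1 (x, - y) = - f1 (x, y)"
    using f mem(1) by (auto simp: slice_components_def)
  moreover have "f (slice_point J x y) = f0 (x, y) + J * f1 (x, y)"
    "f (slice_point J x (- y)) = f0 (x, - y) + J * f1 (x, - y)"
    using f J mem by (auto simp: slice_components_def)
  ultimately show ?thesis
    by (intro that[of p q]) (simp_all add: path slice_point_def)
qed

text \<open>Taking the commutator with \<open>B\<close> is bounded linear and passes under the
  integral, where the contributions of \<open>t\<close> and \<open>- t\<close> cancel.\<close>

lemma commutes_with_omega_integral:
  fixes T :: "('v::banach, 'n::{finite,linorder}) operator"
  assumes T: "bisectorial \<omega> T" and \<omega>: "0 < \<omega>" "\<omega> < \<phi>" "\<phi> < \<theta>" "\<theta> < pi / 2"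
    and J: "J \<in> imag_units" and f: "f \<in> intrinsic (double_sector \<theta>)"
    and B: "commutes_with_resolvents B T"
  shows "B o\<^sub>L omega_integral \<phi> J T f = omega_integral \<phi> J T f o\<^sub>L B"
proof -
  define c where "c \<sigma> t = vector_derivative (sector_path \<phi> J \<sigma>) (at t) * clifford_inverse J
      * f (sector_path \<phi> J \<sigma> t)" for \<sigma> t
  define F where "F \<sigma> t = Blinfun (\<lambda>v. S_L_inv (sector_path \<phi> J \<sigma> t) T (lmult (c \<sigma> t) v))" for \<sigma> t
  define L where "L X = (B o\<^sub>L X) - (X o\<^sub>L B)" for X
  interpret L: bounded_linear L
    unfolding L_def[abs_def]
    by (intro bounded_linear_sub
        bounded_bilinear.bounded_linear_right[OF bounded_bilinear_blinfun_compose]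
        bounded_bilinear.bounded_linear_left[OF bounded_bilinear_blinfun_compose])
  have odd: "L (F \<sigma> t) + L (F \<sigma> (- t)) = 0" if \<sigma>: "\<sigma> = 1 \<or> \<sigma> = -1" and t: "t \<noteq> 0" for \<sigma> t
  proof -
    define x y where "x = \<sigma> * \<bar>t\<bar> * cos \<phi>" and "y = - \<sigma> * t * sin \<phi>"
    let ?s = "slice_point J x y"
    have path: "sector_path \<phi> J \<sigma> t = ?s" "sector_path \<phi> J \<sigma> (- t) = slice_point J x (- y)"
      by (simp_all add: sector_path_slice_point[OF \<sigma>] x_def y_def)
    have s: "?s \<in> bounded_resolvent_set T" "slice_point J x (- y) \<in> bounded_resolvent_set T"
      using sector_path_bounded_resolvent_set[OF T \<omega>(1,2) _ J \<sigma>, of t]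
        sector_path_bounded_resolvent_set[OF T \<omega>(1,2) _ J \<sigma>, of "- t"] \<omega>(3,4) t
      by (simp_all add: path)
    obtain p q where pq: "f (sector_path \<phi> J \<sigma> t) = slice_point J p q"
      "f (sector_path \<phi> J \<sigma> (- t)) = slice_point J p (- q)"
      using intrinsic_on_sector_path[OF f J \<sigma> _ t, of \<phi>] \<omega> by auto
    have d: "vector_derivative (sector_path \<phi> J \<sigma>) (at u)
        = slice_point J (\<sigma> * sgn u * cos \<phi>) (- \<sigma> * sin \<phi>)" if "u \<noteq> 0" for u
      by (rule vector_derivative_at[OF has_vector_derivative_sector_path[OF that]])
    have inv: "clifford_inverse J = slice_point J 0 (- 1)"
      by (simp add: clifford_inverse_imag_unit[OF J] slice_point_scaleR)
    \<comment> \<open>The coordinates of the product of the derivative, -J and the value of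
      \<open>f\<close>. At \<open>- t\<close> the derivative is minus its conjugate, and -J is minus
      its own; the signs cancel, so the whole weight is conjugated.\<close>
    define a b where "a = \<sigma> * (sgn t * cos \<phi> * q - sin \<phi> * p)"
      and "b = - \<sigma> * (sgn t * cos \<phi> * p + sin \<phi> * q)"
    have ab: "c \<sigma> t = slice_point J a b" "c \<sigma> (- t) = slice_point J a (- b)"
      unfolding c_def pq inv d[OF t] d[of "- t", unfolded neg_equal_0_iff_equal, OF t]
        slice_point_mult[OF J] sgn_minus a_def b_def
      by (simp_all add: algebra_simps)
    \<comment> \<open>\<open>Blinfun\<close> represents the given map only once that map is known to
      be bounded linear.\<close>
    have F: "blinfun_apply (F \<sigma> u) = (\<lambda>v. S_L_inv (sector_path \<phi> J \<sigma> u) T (lmult (c \<sigma> u) v))"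
      if "sector_path \<phi> J \<sigma> u \<in> bounded_resolvent_set T" for u
      unfolding F_def using that
      by (intro bounded_linear_Blinfun_apply bounded_linear_compose[OF _ bounded_linear_lmult])
        (simp add: bounded_resolvent_set_def)
    have sum: "blinfun_apply (F \<sigma> t + F \<sigma> (- t)) v
        = (2 * (x * a + y * b)) *\<^sub>R blinfun_apply (Q_inv ?s T) v - (2 * a) *\<^sub>R T_Q_inv ?s T v" for v
      using S_L_inv_conj_sum[OF J s(1)] s
      by (simp add: F path ab plus_blinfun.rep_eq)
    have "L (F \<sigma> t + F \<sigma> (- t)) = 0"
    proof (rule blinfun_eqI)
      fix v
      have "blinfun_apply (Q_inv ?s T) (blinfun_apply B v) = blinfun_apply B (blinfun_apply (Q_inv ?s T) v)"
        "T_Q_inv ?s T (blinfun_apply B v) = blinfun_apply B (T_Q_inv ?s T v)"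
        using B s(1) by (auto simp: commutes_with_resolvents_def)
      then show "blinfun_apply (L (F \<sigma> t + F \<sigma> (- t))) v = blinfun_apply 0 v"
        unfolding L_def minus_blinfun.rep_eq blinfun_apply_blinfun_compose sum
        by (simp add: blinfun.diff_right blinfun.scaleR_right)
    qed
    then show ?thesis by (simp add: L.add)
  qed
  have "L (integral UNIV (F \<sigma>)) = 0" if "\<sigma> = 1 \<or> \<sigma> = -1" for \<sigma>
  proof (cases "F \<sigma> integrable_on UNIV")
    case True
    then have "((\<lambda>t. L (F \<sigma> t)) has_integral L (integral UNIV (F \<sigma>))) UNIV"
      using has_integral_linear[OF integrable_integral L.bounded_linear_axioms] by (simp add: o_def)
    then show ?thesis
      by (rule has_integral_odd_eq_0) (rule odd[OF that])
  next
    case False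
    \<comment> \<open>The default value 0 has commutator 0.\<close>
    then show ?thesis by (simp add: not_integrable_integral L.zero)
  qed
  moreover have "omega_integral \<phi> J T f = (1 / (2 * pi)) *\<^sub>R (\<Sum>\<sigma>\<in>{1, -1}. integral UNIV (F \<sigma>))"
    unfolding omega_integral_def F_def c_def ..
  ultimately have "L (omega_integral \<phi> J T f) = 0"
    by (simp add: L.scaleR L.add)
  then show ?thesis by (simp add: L_def)
qed

section \<open>Commutation carried from the integral to the three calculi\<close>

lemma commutes_with_omega_calculus:
  assumes "bisectorial \<omega> T" "0 < \<omega>" "\<omega> < \<theta>" "\<theta> < pi / 2" "f \<in> intrinsic (double_sector \<theta>)"
    and "commutes_with_resolvents B T"
  shows "B o\<^sub>L omega_calculus \<omega> \<theta> T f = omega_calculus \<omega> \<theta> T f o\<^sub>L B"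
proof -
  have \<phi>: "(SOME \<phi>. \<phi> \<in> {\<omega><..<\<theta>}) \<in> {\<omega><..<\<theta>}"
    unfolding some_in_eq using assms(3) by simp
  have J: "(SOME J. J \<in> imag_units) \<in> (imag_units :: 'b clifford set)"
    unfolding some_in_eq by (rule imag_units_nonempty)
  \<comment> \<open>The membership rule is instantiated at the chosen angle so that the condition
    inside the choice itself stays intact.\<close>
  from \<phi> show ?thesis
    unfolding omega_calculus_def greaterThanLessThan_iff[of "Eps _"]
    by (elim conjE, intro commutes_with_omega_integral[OF assms(1,2) _ _ assms(4) J assms(5,6)])
qed

text \<open>For an imaginary unit \<open>J\<close>, 1 + T^2 is Q_J[T], so its inverse is one of the
  resolvent operators.\<close>

lemma commutes_with_bounded_inverse_one_plus_square:
  assumes T: "bisectorial \<omega> T" "0 < \<omega>" "\<omega> < pi / 2" and B: "commutes_with_resolvents B T"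
  shows "B o\<^sub>L bounded_inverse (one_plus_square T) = bounded_inverse (one_plus_square T) o\<^sub>L B"
proof -
  obtain J :: "'b clifford" where J: "J \<in> imag_units"
    using imag_units_nonempty by blast
  then have J': "scalar_part J = 0" "norm J = 1" "J \<in> paravectors"
    by (auto simp: imag_units_def)
  obtain \<phi> where "\<omega> < \<phi>" "\<phi> < pi / 2"
    using dense T(3) by blast
  moreover from this have "0 \<le> cos \<phi>"
    using T(2) by (intro cos_ge_zero) auto
  ultimately have "J \<in> bounded_resolvent_set T"
    using J' T by (intro bisectorial_bounded_resolvent_set[OF T(1,2)]) auto
  then have "B o\<^sub>L Q_inv J T = Q_inv J T o\<^sub>L B"
    using B by (auto simp: commutes_with_resolvents_def intro: blinfun_eqI)
  moreover have "one_plus_square T = Q_op J T"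
    by (simp add: one_plus_square_def Q_op_def J' fun_eq_iff add.commute)
  ultimately show ?thesis by simp
qed

text \<open>Membership in \<open>N_bnd\<close> makes the chosen components a genuine decomposition,
  so its last part is intrinsic; the rest is linearity.\<close>

lemma commutes_with_extended_calculus:
  assumes T: "bisectorial \<omega> T" and \<omega>: "0 < \<omega>" "\<omega> < \<theta>" "\<theta> < pi / 2" and h: "h \<in> N_bnd \<theta>"
    and B: "commutes_with_resolvents B T"
  shows "B o\<^sub>L extended_calculus \<omega> \<theta> T h = extended_calculus \<omega> \<theta> T h o\<^sub>L B"
proof -
  obtain ginf g0 gt where some: "(SOME (ginf, g0, gt). bnd_decomposition \<theta> h ginf g0 gt) = (ginf, g0, gt)"
    by (cases "SOME (ginf, g0, gt). bnd_decomposition \<theta> h ginf g0 gt") auto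
  have "case (ginf, g0, gt) of (ginf, g0, gt) \<Rightarrow> bnd_decomposition \<theta> h ginf g0 gt"
    unfolding some[symmetric] by (rule someI_ex) (use h in \<open>auto simp: N_bnd_def\<close>)
  then have gt: "gt \<in> intrinsic (double_sector \<theta>)"
    by (simp add: bnd_decomposition_def N0_def)
  have 1: "B o\<^sub>L bounded_inverse (one_plus_square T) = bounded_inverse (one_plus_square T) o\<^sub>L B"
    using \<omega> by (intro commutes_with_bounded_inverse_one_plus_square[OF T _ _ B]) auto
  have 2: "B o\<^sub>L omega_calculus \<omega> \<theta> T gt = omega_calculus \<omega> \<theta> T gt o\<^sub>L B"
    by (rule commutes_with_omega_calculus[OF T \<omega> gt B])
  show ?thesis
  proof (rule blinfun_eqI)
    fix v
    show "blinfun_apply (B o\<^sub>L extended_calculus \<omega> \<theta> T h) v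
        = blinfun_apply (extended_calculus \<omega> \<theta> T h o\<^sub>L B) v"
      unfolding extended_calculus_def some Let_def
      using arg_cong[OF 1, of "\<lambda>X. blinfun_apply X v"] arg_cong[OF 2, of "\<lambda>X. blinfun_apply X v"]
      by (simp add: blinfun.bilinear_simps)
  qed
qed

lemma commutes_with_extended_calculus_apply:
  assumes "bisectorial \<omega> T" "0 < \<omega>" "\<omega> < \<theta>" "\<theta> < pi / 2" "h \<in> N_bnd \<theta>"
    and "commutes_with_resolvents B T"
  shows "blinfun_apply B (blinfun_apply (extended_calculus \<omega> \<theta> T h) v)
       = blinfun_apply (extended_calculus \<omega> \<theta> T h) (blinfun_apply B v)"
  using commutes_with_extended_calculus[OF assms]
  by (metis blinfun_apply_blinfun_compose)

text \<open>Turns g(T) v = w into (eg)(T) v = e(T) w, free of inverses and ranges.\<close>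

lemma inv_eq_Some_iff:
  assumes "inj f"
  shows "(if x \<in> range f then Some (inv f x) else None) = Some w \<longleftrightarrow> x = f w"
  using inv_f_f[OF assms] by (cases "x \<in> range f") auto

text \<open>The relation (eg)(T) w = e(T) u survives applying \<open>B\<close> to both sides and
  moving it inward.\<close>

lemma commutes_with_Hinf_calculus:
  assumes T: "bisectorial \<omega> T" "0 < \<omega>" "\<omega> < \<theta>" "\<theta> < pi / 2"
    and g: "g \<in> N_reg \<omega> \<theta> T" and B: "commutes_with_resolvents B T"
  shows "commutes_with B (Hinf_calculus \<omega> \<theta> T g)"
proof -
  define e where "e = (SOME e. regularizer \<omega> \<theta> T g e)"
  have "\<exists>e. regularizer \<omega> \<theta> T g e"
    using g by (simp add: N_reg_def)
  then have "regularizer \<omega> \<theta> T g e"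
    unfolding e_def by (rule someI_ex)
  then have e: "e \<in> N_bnd \<theta>" "(\<lambda>s. e s * g s) \<in> N_bnd \<theta>"
    and inj: "inj (blinfun_apply (extended_calculus \<omega> \<theta> T e))"
    by (simp_all add: regularizer_def)
  let ?E = "blinfun_apply (extended_calculus \<omega> \<theta> T e)"
  let ?G = "blinfun_apply (extended_calculus \<omega> \<theta> T (\<lambda>s. e s * g s))"
  have H: "Hinf_calculus \<omega> \<theta> T g v = Some w \<longleftrightarrow> ?G v = ?E w" for v w
    unfolding Hinf_calculus_def e_def[symmetric] Let_def by (rule inv_eq_Some_iff[OF inj])
  show ?thesis
    unfolding commutes_with_def H
  proof (intro allI impI)
    fix w u assume "?G w = ?E u"
    then show "?G (blinfun_apply B w) = ?E (blinfun_apply B u)"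
      by (simp only: commutes_with_extended_calculus_apply[OF T e(1) B, symmetric]
          commutes_with_extended_calculus_apply[OF T e(2) B, symmetric])
  qed
qed

theorem corollary5p11:
  fixes T :: "('v::banach, 'n::{finite,linorder}) operator"
    and \<omega> \<theta> :: real
    and g :: "'n clifford \<Rightarrow> 'n clifford"
  assumes "T \<in> closed_operators"
    and "0 < \<omega>" and "\<omega> < pi / 2"
    and "bisectorial \<omega> T"
    and "\<omega> < \<theta>" and "\<theta> < pi / 2"
    and "g \<in> N_reg \<omega> \<theta> T"
  shows "(\<forall>B\<in>bounded_operators. total_op B \<circ>\<^sub>m T \<subseteq>\<^sub>m T \<circ>\<^sub>m total_op B \<longrightarrow>
            total_op B \<circ>\<^sub>m Hinf_calculus \<omega> \<theta> T g \<subseteq>\<^sub>m Hinf_calculus \<omega> \<theta> T g \<circ>\<^sub>m total_op B) \<and>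
         (\<forall>f\<in>N_bnd \<theta>.
            total_op (extended_calculus \<omega> \<theta> T f) \<circ>\<^sub>m Hinf_calculus \<omega> \<theta> T g
            \<subseteq>\<^sub>m Hinf_calculus \<omega> \<theta> T g \<circ>\<^sub>m total_op (extended_calculus \<omega> \<theta> T f))"
proof (intro conjI ballI impI)
  note H = commutes_with_Hinf_calculus[OF assms(4,2,5,6,7)]
  show "total_op B \<circ>\<^sub>m Hinf_calculus \<omega> \<theta> T g \<subseteq>\<^sub>m Hinf_calculus \<omega> \<theta> T g \<circ>\<^sub>m total_op B"
    if "total_op B \<circ>\<^sub>m T \<subseteq>\<^sub>m T \<circ>\<^sub>m total_op B" for B
    using that unfolding total_op_comp_le_iff_commutes_with
    by (intro H commutes_with_imp_resolvents)
  show "total_op (extended_calculus \<omega> \<theta> T f) \<circ>\<^sub>m Hinf_calculus \<omega> \<theta> T g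
      \<subseteq>\<^sub>m Hinf_calculus \<omega> \<theta> T g \<circ>\<^sub>m total_op (extended_calculus \<omega> \<theta> T f)" if "f \<in> N_bnd \<theta>" for f
    unfolding total_op_comp_le_iff_commutes_with
    \<comment> \<open>f(T) commutes with everything that commutes with the resolvents, hence with
      the resolvents themselves, and so can serve as \<open>B\<close>.\<close>
    by (rule H[OF commutes_with_resolventsI[OF assms(1)
        commutes_with_extended_calculus_apply[OF assms(4,2,5,6) that]]])
qed

end
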